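(* Let $n\ge2$ and let $Q_0\subset\mathbb{R}^{n-1}$ be an arbitrary half-open cube, or $Q_0=\mathbb{R}^{n-1}$. For every $Q\in\mathbb{D}_{Q_0}$ assume that there exist two non-negative functions $G_Q,H_Q\in L^1_{\rm loc}(\mathbb{R}^{n-1})$ such that $$G_Q(x')\leq H_Q(x')\quad\text{for a.e. }x'\in Q,$$ and, for every $Q'\in\mathbb{D}_{Q}\setminus\{Q\}$, $$G_Q(x')\leq G_{Q'}(x')+H_Q(y')\quad\text{for a.e. }x'\in Q'\text{ and for a.e. }y'\in\widehat{Q'},$$ where $\widehat{Q'}$ is the dyadic parent of $Q'$. For each $\alpha\in(0,1)$ define $$\mathfrak{m}_{\alpha}:=\sup_{Q\in\mathbb{D}_{Q_0}}\inf\big\{\lambda>0:\,|\{x'\in Q: H_Q(x')>\lambda\}|\leq\alpha|Q|\big\}.$$ Then, for every $\alpha\in(0,1)$, $$\sup_{Q\in\mathbb{D}_{Q_0}}\frac{|\{x'\in Q:\,G_Q(x')>t\}|}{|Q|}\leq\frac{1}{\alpha}\,e^{-\log(\alpha^{-1})\,\frac{t}{\mathfrak{m}_{\alpha}}}\quad\text{for all }t>0.$$ As a consequence, $$\sup_{Q\in\mathbb{D}_{Q_0}}\|G_Q\|_{\exp L,Q}\leq\frac{1+\alpha^{-1}}{\log(\alpha^{-1})}\,\mathfrak{m}_{\alpha},$$ and for every $q\in(0,\infty)$ there exists a finite constant $C_q>0$ depending only on $q$ such that $$\sup_{Q\in\mathbb{D}_{Q_0}}\Big(\fint_{Q}G_Q(x')^q\,dx'\Big)^{1/q}\leq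 C_q\frac{1}{\alpha^{1/q}\log(\alpha^{-1})}\,\mathfrak{m}_{\alpha}.$$
   Context: Cubes in $\mathbb{R}^{n-1}$ are half-open with sides parallel to the axes: $Q=[a_1,a_1+\ell(Q))\times\dots\times[a_{n-1},a_{n-1}+\ell(Q))$ with $a_i\in\mathbb{R}$, $\ell(Q)>0$. For a cube $Q$, $\mathbb{D}_Q$ is the collection of all half-open dyadic subcubes of $Q$ (obtained by repeated dyadic subdivision, including $Q$ itself); for $Q_0=\mathbb{R}^{n-1}$, $\mathbb{D}_{Q_0}$ is the classical dyadic grid generated by $[0,1)^{n-1}$ (or any other dyadic grid). The dyadic parent $\widehat{Q'}$ of $Q'\in\mathbb{D}_Q\setminus\{Q\}$ is the unique cube in $\mathbb{D}_Q$ containing $Q'$ with $\ell(\widehat{Q'})=2\ell(Q')$. $|\cdot|$ is Lebesgue measure in $\mathbb{R}^{n-1}$, $\fint_Q h=\frac1{|Q|}\int_Q h$, and $\|f\|_{\exp L,Q}:=\inf\{t>0:\fint_Q(e^{|f(x')|/t}-1)\,dx'\le1\}$. Conventions: $e^{-\log(\alpha^{-1})t/\mathfrak{m}_\alpha}$ is read as $0$ if $\mathfrak{m}_\alpha=0$ and as $1$ if $\mathfrak{m}_\alpha=\infty$. *)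

theory Defs
  imports "HOL-Analysis.Analysis"
begin

text \<open>
  Points of \<open>\<real>\<^sup>d\<close> are extensional functions on \<open>{..<d}\<close>: with \<open>d\<close> a natural number rather than a
  type, a constant can be required to be independent of the dimension.
\<close>

definition leb :: "nat \<Rightarrow> (nat \<Rightarrow> real) measure" where
  "leb d = completion (Pi\<^sub>M {..<d} (\<lambda>_. lborel))"

text \<open>The topology below is the Euclidean one; its underlying set is \<open>{..<d} \<rightarrow>\<^sub>E UNIV = space (leb d)\<close>.\<close>

definition L1_loc :: "nat \<Rightarrow> ((nat \<Rightarrow> real) \<Rightarrow> real) set" where
  "L1_loc d = {f. f \<in> borel_measurable (leb d) \<and>
     (\<forall>K. compactin (product_topology (\<lambda>_. euclideanreal) {..<d}) K \<longrightarrow> set_integrable (leb d) K f)}"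

definition cube :: "nat \<Rightarrow> (nat \<Rightarrow> real) \<Rightarrow> real \<Rightarrow> (nat \<Rightarrow> real) set" where
  "cube d a l = (\<Pi>\<^sub>E i\<in>{..<d}. {a i..<a i + l})"

inductive_set dyadic_subcubes :: "nat \<Rightarrow> (nat \<Rightarrow> real) set \<Rightarrow> (nat \<Rightarrow> real) set set"
  for d :: nat and Q :: "(nat \<Rightarrow> real) set" where
  self: "Q \<in> dyadic_subcubes d Q"
| subdivide: "\<lbrakk>cube d a l \<in> dyadic_subcubes d Q; 0 < l; \<And>i. i < d \<Longrightarrow> b i = a i \<or> b i = a i + l / 2\<rbrakk>
    \<Longrightarrow> cube d b (l / 2) \<in> dyadic_subcubes d Q"

definition dyadic_parent :: "nat \<Rightarrow> (nat \<Rightarrow> real) set \<Rightarrow> (nat \<Rightarrow> real) set \<Rightarrow> (nat \<Rightarrow> real) set \<Rightarrow> bool" where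
  "dyadic_parent d Q Q' P \<longleftrightarrow> P \<in> dyadic_subcubes d Q \<and> Q' \<subseteq> P \<and>
     (\<exists>a b l. 0 < l \<and> Q' = cube d a l \<and> P = cube d b (2 * l))"

text \<open>
  A dyadic grid of the whole space: for some base length \<open>l0\<close>, the cubes of side length \<open>2\<^sup>k l0\<close>
  partition the space for each integer \<open>k\<close>, and consecutive generations are related by dyadic
  subdivision.
\<close>

definition dyadic_grid :: "nat \<Rightarrow> (nat \<Rightarrow> real) set set \<Rightarrow> bool" where
  "dyadic_grid d D \<longleftrightarrow> (\<exists>l0>0.
     (\<forall>Q\<in>D. \<exists>a (k::int). Q = cube d a (l0 * 2 powi k)) \<and>
     (\<forall>k::int. \<forall>x\<in>space (leb d). \<exists>!Q. Q \<in> D \<and> x \<in> Q \<and> (\<exists>a. Q = cube d a (l0 * 2 powi k))) \<and>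
     (\<forall>Q\<in>D. dyadic_subcubes d Q \<subseteq> D))"

definition dyadic_family :: "nat \<Rightarrow> (nat \<Rightarrow> real) set \<Rightarrow> (nat \<Rightarrow> real) set set \<Rightarrow> bool" where
  "dyadic_family d Q0 D \<longleftrightarrow>
     (\<exists>a l. 0 < l \<and> Q0 = cube d a l) \<and> D = dyadic_subcubes d Q0 \<or>
     Q0 = space (leb d) \<and> dyadic_grid d D"

definition superlevel :: "((nat \<Rightarrow> real) \<Rightarrow> real) \<Rightarrow> (nat \<Rightarrow> real) set \<Rightarrow> real \<Rightarrow> (nat \<Rightarrow> real) set" where
  "superlevel f Q t = {x \<in> Q. f x > t}"

definition m_alpha :: "nat \<Rightarrow> (nat \<Rightarrow> real) set set \<Rightarrow> ((nat \<Rightarrow> real) set \<Rightarrow> (nat \<Rightarrow> real) \<Rightarrow> real) \<Rightarrow> real \<Rightarrow> ennreal" where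
  "m_alpha d D H \<alpha> = (SUP Q\<in>D. INF r\<in>{r. 0 < r \<and>
     emeasure (leb d) (superlevel (H Q) Q r) \<le> ennreal \<alpha> * emeasure (leb d) Q}. ennreal r)"

definition decay :: "real \<Rightarrow> ennreal \<Rightarrow> real \<Rightarrow> real" where
  "decay \<alpha> m t = (if m = 0 then 0 else if m = \<infinity> then 1
     else exp (- (ln (inverse \<alpha>) * (t / enn2real m))))"

definition nn_average :: "nat \<Rightarrow> (nat \<Rightarrow> real) set \<Rightarrow> ((nat \<Rightarrow> real) \<Rightarrow> real) \<Rightarrow> ennreal" where
  "nn_average d Q f = (\<integral>\<^sup>+x\<in>Q. ennreal (f x) \<partial>leb d) / emeasure (leb d) Q"

definition expL_norm :: "nat \<Rightarrow> (nat \<Rightarrow> real) set \<Rightarrow> ((nat \<Rightarrow> real) \<Rightarrow> real) \<Rightarrow> ennreal" where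
  "expL_norm d Q f = (INF t\<in>{t. 0 < t \<and> nn_average d Q (\<lambda>x. exp (\<bar>f x\<bar> / t) - 1) \<le> 1}. ennreal t)"

definition ennreal_powr :: "ennreal \<Rightarrow> real \<Rightarrow> ennreal" where
  "ennreal_powr x p = (if x = \<infinity> then \<infinity> else ennreal (enn2real x powr p))"

text \<open>Non-vacuity: the classical grid generated by the unit cube is a dyadic grid.\<close>

lemma cube_eqD:
  assumes "1 \<le> d" "0 < l" "0 < l'" and eq: "cube d a l = cube d a' l'"
  shows "l = l'" and "\<And>i. i < d \<Longrightarrow> a i = a' i"
proof -
  have *: "{a i..<a i + l} = {a' i..<a' i + l'}" if "i < d" for i
    using eq that assms(2,3) unfolding cube_def by (subst (asm) PiE_eq_iff) auto
  have **: "a i = a' i \<and> a i + l = a' i + l'" if "i < d" for i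
    using *[OF that] assms(2,3) by (subst (asm) atLeastLessThan_eq_iff) auto
  show "\<And>i. i < d \<Longrightarrow> a i = a' i" using ** by blast
  show "l = l'" using **[of 0] assms(1) by auto
qed

definition classical_grid :: "nat \<Rightarrow> (nat \<Rightarrow> real) set set" where
  "classical_grid d = {cube d (\<lambda>i. of_int (k i) * 2 powi j) (2 powi j) |k (j::int). True}"

lemma dyadic_grid_classical:
  assumes "1 \<le> d"
  shows "dyadic_grid d (classical_grid d)"
proof -
  have sub: "R \<in> classical_grid d" if "Q \<in> classical_grid d" "R \<in> dyadic_subcubes d Q" for Q R
    using that(2)
  proof (induction rule: dyadic_subcubes.induct)
    case self
    then show ?case using that(1) .
  next
    case (subdivide a l b)
    then obtain k and j :: int where kj: "cube d a l = cube d (\<lambda>i. of_int (k i) * 2 powi j) (2 powi j)"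
      by (auto simp: classical_grid_def)
    have l: "l = 2 powi j" and a: "\<And>i. i < d \<Longrightarrow> a i = of_int (k i) * 2 powi j"
      using cube_eqD[OF assms \<open>0 < l\<close> _ kj] by auto
    have half: "l / 2 = 2 powi (j - 1)" unfolding l by (simp add: power_int_diff)
    define k' where "k' i = (if b i = a i then 2 * k i else 2 * k i + 1)" for i
    have "b i = of_int (k' i) * 2 powi (j - 1)" if "i < d" for i
      using subdivide.hyps(3)[OF that] a[OF that] l
      by (auto simp: k'_def power_int_diff field_simps)
    then have "cube d b (l / 2) = cube d (\<lambda>i. of_int (k' i) * 2 powi (j - 1)) (2 powi (j - 1))"
      unfolding half cube_def by (intro PiE_cong) auto
    then show ?case unfolding classical_grid_def by blast
  qed
  have part: "\<exists>!Q. Q \<in> classical_grid d \<and> x \<in> Q \<and> (\<exists>a. Q = cube d a (2 powi j))"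
    if x: "x \<in> space (leb d)" for x and j :: int
  proof -
    have ext: "x \<in> extensional {..<d}" using x by (simp add: leb_def space_PiM PiE_def)
    have fl: "of_int m * 2 powi j \<le> y \<and> y < of_int m * 2 powi j + 2 powi j \<longleftrightarrow> m = \<lfloor>y / 2 powi j\<rfloor>"
      for y :: real and m :: int
    proof -
      have "of_int m * 2 powi j \<le> y \<and> y < of_int m * 2 powi j + 2 powi j
          \<longleftrightarrow> of_int m \<le> y / 2 powi j \<and> y / 2 powi j < of_int m + 1"
        by (simp add: pos_le_divide_eq pos_divide_less_eq distrib_right)
      then show ?thesis using floor_eq_iff[of "y / 2 powi j" m] by auto
    qed
    define Q where "Q = cube d (\<lambda>i. of_int \<lfloor>x i / 2 powi j\<rfloor> * 2 powi j) (2 powi j)"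
    have xQ: "x \<in> Q" unfolding Q_def cube_def PiE_def using ext fl by auto
    show ?thesis
    proof (rule ex1I[of _ Q])
      show "Q \<in> classical_grid d \<and> x \<in> Q \<and> (\<exists>a. Q = cube d a (2 powi j))"
        using xQ by (auto simp: Q_def classical_grid_def)
      fix R assume R: "R \<in> classical_grid d \<and> x \<in> R \<and> (\<exists>a. R = cube d a (2 powi j))"
      then obtain a k i where a: "R = cube d a (2 powi j)"
        and k: "R = cube d (\<lambda>n. of_int (k n) * 2 powi i) (2 powi i)"
        by (auto simp: classical_grid_def)
      have ij: "2 powi i = (2 powi j :: real)"
        using cube_eqD(1)[OF assms, of "2 powi i" "2 powi j"] a k by auto
      have "k n = \<lfloor>x n / 2 powi j\<rfloor>" if "n < d" for n
        using R k that fl[of "k n" "x n"] ij by (auto simp: cube_def)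
      then show "R = Q" unfolding k Q_def ij cube_def by (intro PiE_cong) auto
    qed
  qed
  have form: "\<forall>Q\<in>classical_grid d. \<exists>a (j::int). Q = cube d a (2 powi j)"
    unfolding classical_grid_def by blast
  have "\<forall>Q\<in>classical_grid d. dyadic_subcubes d Q \<subseteq> classical_grid d"
    using sub by blast
  then show ?thesis unfolding dyadic_grid_def
    using form part by (intro exI[of _ 1]) simp
qed

end

theory Submission
  imports Defs
begin

text \<open>
  Fix \<open>Q\<close> and let \<open>F = {x \<in> Q. H Q x > \<mu>}\<close> with \<open>\<mu>\<close> the supremum of the \<open>\<alpha>\<close>-quantiles, so that \<open>|F| \<le> \<alpha> |Q|\<close>.
  Cover \<open>F\<close> by a relatively open \<open>U\<close> with \<open>|U| \<le> \<beta> |Q|\<close>, \<open>\<alpha> < \<beta> < 1\<close>, and take the maximal dyadic cubes \<open>R\<close> that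
  are contained in \<open>U\<close> up to a null set. They are disjoint, cover \<open>F\<close>, and have total measure at most \<open>\<beta> |Q|\<close>;
  by maximality the parent of each contains a non-null set of points \<open>y\<close> with \<open>H Q y \<le> \<mu>\<close>, so that
  \<open>G Q \<le> G R + \<mu>\<close> a.e. on \<open>R\<close>. Letting \<open>\<beta> \<rightarrow> \<alpha>\<close>, the worst distribution function gains a factor \<open>\<alpha>\<close> each time
  \<open>t\<close> grows by \<open>\<mu>\<close>. Defining the stopping cubes through \<open>U\<close> instead of \<open>F\<close> makes Lebesgue's differentiation
  theorem unnecessary. The norm bounds follow from the layer cake formula for \<open>exp (c s) - 1\<close>, the \<open>L\<^sup>q\<close> bound
  via \<open>s\<^sup>q \<le> (2 q / b)\<^sup>q exp (b s / 2)\<close>.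
\<close>

subsection \<open>Measure of cubes and outer regularity\<close>

lemma space_leb: "space (leb d) = extensional {..<d}"
  by (simp add: leb_def space_PiM PiE_UNIV_domain PiE_def)

lemma cube_subset_space: "cube d a l \<subseteq> space (leb d)"
  unfolding cube_def space_leb PiE_def by blast

lemma cube_PiM_sets: "cube d a l \<in> sets (Pi\<^sub>M {..<d} (\<lambda>_. lborel))"
  unfolding cube_def by (rule sets_PiM_I_finite) auto

lemma cube_sets [measurable]: "cube d a l \<in> sets (leb d)"
  unfolding leb_def using cube_PiM_sets by (rule sets_completionI_sets)

lemma emeasure_cube:
  assumes "0 \<le> l"
  shows "emeasure (leb d) (cube d a l) = ennreal (l ^ d)"
proof -
  interpret product_sigma_finite "\<lambda>_::nat. lborel :: real measure"
    by (simp add: product_sigma_finite_def sigma_finite_lborel)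
  have "emeasure (leb d) (cube d a l) = emeasure (Pi\<^sub>M {..<d} (\<lambda>_. lborel)) (cube d a l)"
    unfolding leb_def using cube_PiM_sets by simp
  also have "\<dots> = (\<Prod>i<d. ennreal l)"
    unfolding cube_def using assms by (subst emeasure_PiM) auto
  finally show ?thesis
    using assms by (simp add: ennreal_power)
qed

lemma measure_cube_pos: "0 < l \<Longrightarrow> 0 < measure (leb d) (cube d a l)"
  by (simp add: measure_def emeasure_cube)

lemma fmeasurable_cube: "0 \<le> l \<Longrightarrow> cube d a l \<in> fmeasurable (leb d)"
  by (rule fmeasurableI) (auto simp: emeasure_cube)

text \<open>Outer regularity is applied to a finite Borel measure on a Polish space. To get there,
  Lebesgue measure on the cube is pushed forward to the product space
  \<open>nat \<Rightarrow> real\<close>, and \<open>F\<close> is enlarged to a Borel set without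
  gaining measure on the cube. \<open>U\<close> is open in this larger space, and only its trace on
  the cube is measured.\<close>

lemma outer_open_approximation:
  assumes F: "F \<in> sets (leb d)" "F \<subseteq> cube d a l" and l: "0 \<le> l" and e: "0 < e"
  obtains U where "open U" "F \<subseteq> U" "U \<inter> cube d a l \<in> sets (leb d)"
    "measure (leb d) (U \<inter> cube d a l) \<le> measure (leb d) F + e"
proof -
  define N where "N = Pi\<^sub>M {..<d} (\<lambda>_. lborel :: real measure)"
  define Q where "Q = cube d a l"
  have leb: "leb d = completion N" by (simp add: leb_def N_def)
  have QN [measurable]: "Q \<in> sets N" unfolding Q_def N_def by (rule cube_PiM_sets)
  have Q_space: "Q \<subseteq> extensional {..<d}" unfolding Q_def cube_def PiE_def by blast
  have id_meas [measurable]: "(\<lambda>x. x) \<in> N \<rightarrow>\<^sub>M (borel :: (nat \<Rightarrow> real) measure)"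
  proof (rule measurable_coordinatewise_then_product)
    fix i
    show "(\<lambda>x. x i) \<in> borel_measurable N"
    proof (cases "i < d")
      case True
      then have "(\<lambda>x. x i) \<in> N \<rightarrow>\<^sub>M (lborel :: real measure)"
        unfolding N_def by (intro measurable_component_singleton) auto
      then show ?thesis by simp
    next
      case False
      then have "x i = undefined" if "x \<in> space N" for x
        using that by (auto simp: N_def space_PiM PiE_def extensional_def)
      then have "(\<lambda>x. x i) \<in> borel_measurable N \<longleftrightarrow> (\<lambda>_. undefined :: real) \<in> borel_measurable N"
        by (intro measurable_cong) blast
      then show ?thesis by simp
    qed
  qed
  have restr [measurable]: "(\<lambda>x. restrict x {..<d}) \<in> (borel :: (nat \<Rightarrow> real) measure) \<rightarrow>\<^sub>M N"
    unfolding N_def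
  proof (rule measurable_restrict)
    fix i
    have "continuous_on UNIV (\<lambda>x::nat \<Rightarrow> real. x i)" by (rule continuous_on_product_coordinates)
    then show "(\<lambda>x::nat \<Rightarrow> real. x i) \<in> borel \<rightarrow>\<^sub>M lborel"
      by (simp add: borel_measurable_continuous_onI)
  qed
  define M where "M = distr (density N (indicator Q)) borel (\<lambda>x. x)"
  have M: "emeasure M B = emeasure N (B \<inter> Q)" if "B \<in> sets borel" for B
  proof -
    have "B \<inter> space N \<in> sets N"
      using measurable_sets[OF id_meas that] by simp
    then have "emeasure M B = (\<integral>\<^sup>+x. indicator Q x * indicator (B \<inter> space N) x \<partial>N)"
      using that by (simp add: M_def emeasure_distr emeasure_density)
    also have "\<dots> = (\<integral>\<^sup>+x. indicator (B \<inter> Q) x \<partial>N)"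
      by (rule nn_integral_cong) (auto split: split_indicator)
    also have "\<dots> = emeasure N (B \<inter> Q)"
    proof -
      have "B \<inter> Q = (B \<inter> space N) \<inter> Q" using sets.sets_into_space[OF QN] by auto
      then have "B \<inter> Q \<in> sets N" using \<open>B \<inter> space N \<in> sets N\<close> by simp
      then show ?thesis by simp
    qed
    finally show ?thesis .
  qed
  have fin: "emeasure N Q < \<infinity>"
    using emeasure_cube[OF l, of d a] by (simp add: leb Q_def[symmetric])
  \<comment> \<open>\<open>F\<close> is measurable only for the completion; \<open>F'\<close> is a
    superset of equal measure in the product sigma-algebra.\<close>
  obtain F' where F': "F' \<in> sets N" "F \<subseteq> F'" "emeasure (completion N) F = emeasure N F'"
    using completion_upper[of F N] F(1) leb by auto
  \<comment> \<open>\<open>restrict\<close> is the identity on the cube, so this preimage is Borel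
    in the full product space and has the same trace on the cube as \<open>F'\<close>.\<close>
  define B where "B = (\<lambda>x. restrict x {..<d}) -` (F' \<inter> Q)"
  have B: "B \<in> sets borel"
    using measurable_sets[OF restr, of "F' \<inter> Q"] F' by (simp add: B_def)
  have BQ: "B \<inter> Q = F' \<inter> Q"
    using Q_space unfolding B_def by (auto simp: extensional_restrict subset_eq)
  have FB: "F \<subseteq> B"
    using F(2) F'(2) Q_space unfolding B_def Q_def[symmetric]
    by (auto simp: extensional_restrict subset_eq)
  have "emeasure M B = (INF U \<in> {U. B \<subseteq> U \<and> open U}. emeasure M U)"
  proof (rule outer_regular)
    show "sets M = sets borel" by (simp add: M_def)
    have "emeasure M (space M) = emeasure N Q" using M[of UNIV] by (simp add: M_def)
    then show "emeasure M (space M) \<noteq> \<infinity>" using fin by simp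
  qed (rule B)
  moreover have FM: "emeasure M B \<le> emeasure (leb d) F"
    unfolding M[OF B] BQ leb F'(3) using F' by (intro emeasure_mono) auto
  have fF: "F \<in> fmeasurable (leb d)"
    by (rule fmeasurableI2[OF fmeasurable_cube[OF l] F(2,1)])
  have "emeasure M B < emeasure (leb d) F + ennreal e"
  proof -
    have "emeasure (leb d) F < emeasure (leb d) F + ennreal e"
      using fF e by (simp add: emeasure_eq_measure2 ennreal_less_iff flip: ennreal_plus)
    then show ?thesis using FM by (rule le_less_trans[rotated])
  qed
  ultimately obtain U where U: "B \<subseteq> U" "open U" "emeasure M U < emeasure (leb d) F + ennreal e"
    by (auto simp: INF_less_iff)
  have UQ: "U \<inter> Q \<in> sets N"
  proof -
    have "U \<inter> Q = ((\<lambda>x. x) -` U \<inter> space N) \<inter> Q" using sets.sets_into_space[OF QN] by auto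
    moreover have "(\<lambda>x. x) -` U \<inter> space N \<in> sets N" using U by (intro measurable_sets[OF id_meas]) auto
    ultimately show ?thesis by simp
  qed
  have "emeasure (leb d) (U \<inter> Q) < emeasure (leb d) F + ennreal e"
    using U M[of U] UQ by (simp add: leb)
  moreover have fU: "U \<inter> Q \<in> fmeasurable (leb d)"
    using fmeasurable_cube[OF l, of d a] unfolding Q_def[symmetric]
    by (rule fmeasurableI2) (use UQ in \<open>simp_all add: leb\<close>)
  ultimately have "ennreal (measure (leb d) (U \<inter> Q)) < ennreal (measure (leb d) F + e)"
    using e unfolding emeasure_eq_measure2[OF fF] emeasure_eq_measure2[OF fU]
    by (simp add: ennreal_plus)
  then have "measure (leb d) (U \<inter> Q) \<le> measure (leb d) F + e"
    by (simp add: ennreal_less_iff)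
  moreover have "F \<subseteq> U" using FB U(1) by (rule order_trans)
  moreover have "U \<inter> Q \<in> sets (leb d)" using fU by (rule fmeasurableD)
  ultimately show thesis
    using that[of U] U(2) unfolding Q_def by blast
qed

subsection \<open>Dyadic grids inside a cube\<close>

text \<open>Integer address, coordinate by coordinate, of the generation-\<open>k\<close> cube
  around \<open>x\<close> once the base cube is rescaled to the unit cube.\<close>

definition grid_index :: "(nat \<Rightarrow> real) \<Rightarrow> real \<Rightarrow> nat \<Rightarrow> (nat \<Rightarrow> real) \<Rightarrow> nat \<Rightarrow> int" where
  "grid_index a l k x i = \<lfloor>(x i - a i) / l * 2 ^ k\<rfloor>"

definition grid_cube :: "nat \<Rightarrow> (nat \<Rightarrow> real) \<Rightarrow> real \<Rightarrow> nat \<Rightarrow> (nat \<Rightarrow> real) \<Rightarrow> (nat \<Rightarrow> real) set" where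
  "grid_cube d a l k x = cube d (\<lambda>i. a i + of_int (grid_index a l k x i) * (l / 2 ^ k)) (l / 2 ^ k)"

text \<open>The half-open intervals of the grid are exactly the fibres of the floor in
  \<open>grid_index\<close>. Cubes of one generation thus become classes of an equivalence relation,
  and disjointness and nesting reduce to equality of addresses.\<close>

lemma mem_grid_cube_iff:
  assumes "0 < l"
  shows "y \<in> grid_cube d a l k x \<longleftrightarrow>
    y \<in> extensional {..<d} \<and> (\<forall>i<d. grid_index a l k y i = grid_index a l k x i)"
proof -
  have "y i \<in> {a i + of_int m * (l / 2 ^ k)..<a i + of_int m * (l / 2 ^ k) + l / 2 ^ k}
      \<longleftrightarrow> grid_index a l k y i = m" for m i
  proof -
    have "grid_index a l k y i = m \<longleftrightarrow>
        of_int m \<le> (y i - a i) / l * 2 ^ k \<and> (y i - a i) / l * 2 ^ k < of_int m + 1"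
      unfolding grid_index_def by (simp add: floor_eq_iff)
    also have "\<dots> \<longleftrightarrow> of_int m * (l / 2 ^ k) \<le> y i - a i \<and> y i - a i < (of_int m + 1) * (l / 2 ^ k)"
      using assms by (simp add: field_simps)
    also have "(of_int m + 1) * (l / 2 ^ k) = of_int m * (l / 2 ^ k) + l / 2 ^ k"
      by (simp only: distrib_right mult_1_left)
    finally show ?thesis by (auto simp del: times_divide_eq_right)
  qed
  then show ?thesis unfolding grid_cube_def cube_def PiE_iff by auto
qed

lemma grid_cube_eqI:
  assumes "0 < l" "y \<in> grid_cube d a l k x"
  shows "grid_cube d a l k y = grid_cube d a l k x"
  using assms by (auto simp: mem_grid_cube_iff)

text \<open>The floor of z / 2 is the floor of z, divided by 2 as an integer. An address therefore
  determines the addresses of all ancestors, which is what nests the generations.\<close>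

lemma grid_index_Suc: "grid_index a l k x i = grid_index a l (Suc k) x i div 2"
  using floor_divide_real_eq_div[of 2 "(x i - a i) / l * 2 ^ Suc k"]
  by (simp add: grid_index_def)

lemma grid_cube_Suc_subset:
  "0 < l \<Longrightarrow> grid_cube d a l (Suc k) x \<subseteq> grid_cube d a l k x"
  by (auto simp: mem_grid_cube_iff grid_index_Suc[of a l k])

lemma grid_cube_antimono:
  assumes "0 < l" "j \<le> k"
  shows "grid_cube d a l k x \<subseteq> grid_cube d a l j x"
  using assms(2) grid_cube_Suc_subset[OF assms(1)] by (induction k rule: dec_induct) blast+

lemma grid_cube_0:
  assumes "0 < l" "x \<in> cube d a l"
  shows "grid_cube d a l 0 x = cube d a l"
proof -
  have "grid_index a l 0 x i = 0" if "i < d" for i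
    using assms that by (auto simp: cube_def PiE_iff grid_index_def floor_eq_iff field_simps)
  then show ?thesis unfolding grid_cube_def cube_def by (intro PiE_cong) auto
qed

lemma grid_cube_subset:
  "0 < l \<Longrightarrow> x \<in> cube d a l \<Longrightarrow> grid_cube d a l k x \<subseteq> cube d a l"
  using grid_cube_antimono[of l 0 k d a x] grid_cube_0[of l x d a] by auto

lemma grid_cube_self: "0 < l \<Longrightarrow> x \<in> cube d a l \<Longrightarrow> x \<in> grid_cube d a l k x"
  using cube_subset_space[of d a l] by (auto simp: mem_grid_cube_iff space_leb)

text \<open>Induction on the generation: the parity of the new address \<open>m\<close> decides
  between the lower and the upper half of the side of the parent, whose address is
  \<open>m div 2\<close>. These are the two choices in \<open>subdivide\<close>.\<close>

lemma grid_cube_dyadic: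
  assumes "0 < l" "x \<in> cube d a l"
  shows "grid_cube d a l k x \<in> dyadic_subcubes d (cube d a l)"
proof (induction k)
  case 0
  show ?case using grid_cube_0[OF assms] by (simp add: dyadic_subcubes.self)
next
  case (Suc k)
  have "cube d (\<lambda>i. a i + of_int (grid_index a l (Suc k) x i) * (l / 2 ^ Suc k)) (l / 2 ^ k / 2)
      \<in> dyadic_subcubes d (cube d a l)"
  proof (rule dyadic_subcubes.subdivide[OF Suc[unfolded grid_cube_def]])
    show "0 < l / 2 ^ k" using assms by simp
    fix i
    define m where "m = grid_index a l (Suc k) x i"
    have k: "grid_index a l k x i = m div 2" unfolding m_def by (rule grid_index_Suc)
    have "real_of_int m = 2 * real_of_int (m div 2) \<or> real_of_int m = 2 * real_of_int (m div 2) + 1"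
    proof -
      have "m = 2 * (m div 2) \<or> m = 2 * (m div 2) + 1" by presburger
      then show ?thesis by (metis of_int_1 of_int_add of_int_mult of_int_numeral)
    qed
    then have "real_of_int m * (l / 2 ^ Suc k) = real_of_int (m div 2) * (l / 2 ^ k) \<or>
       real_of_int m * (l / 2 ^ Suc k) = real_of_int (m div 2) * (l / 2 ^ k) + l / 2 ^ k / 2"
      by (elim disj_forward) (simp_all add: field_simps)
    then show "a i + of_int (grid_index a l (Suc k) x i) * (l / 2 ^ Suc k) =
          a i + of_int (grid_index a l k x i) * (l / 2 ^ k) \<or>
        a i + of_int (grid_index a l (Suc k) x i) * (l / 2 ^ Suc k) =
          a i + of_int (grid_index a l k x i) * (l / 2 ^ k) + l / 2 ^ k / 2"
      unfolding k m_def[symmetric] by auto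
  qed
  then show ?case by (simp add: grid_cube_def mult.commute)
qed

lemma grid_cube_dyadic_parent:
  assumes "0 < l" "x \<in> cube d a l"
  shows "dyadic_parent d (cube d a l) (grid_cube d a l (Suc k) x) (grid_cube d a l k x)"
proof -
  have "grid_cube d a l k x = cube d (\<lambda>i. a i + of_int (grid_index a l k x i) * (l / 2 ^ k)) (2 * (l / 2 ^ Suc k))"
    by (simp add: grid_cube_def)
  moreover have "0 < l / 2 ^ Suc k" using assms(1) by simp
  ultimately show ?thesis
    unfolding dyadic_parent_def
    using grid_cube_dyadic[OF assms] grid_cube_Suc_subset[OF assms(1)] grid_cube_def[of d a l "Suc k" x]
    by blast
qed

text \<open>The side lengths differ. In dimension 0 all cubes would be the same one-point set, hence
  \<open>1 \<le> d\<close>. Stopping cubes have to be proper because the hypothesis comparing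
  \<open>G Q\<close> with \<open>G Q'\<close> excludes \<open>Q' = Q\<close>.\<close>

lemma grid_cube_Suc_neq:
  assumes "1 \<le> d" "0 < l"
  shows "grid_cube d a l (Suc k) x \<noteq> cube d a l"
proof
  assume "grid_cube d a l (Suc k) x = cube d a l"
  then have "l / 2 ^ Suc k = l"
    unfolding grid_cube_def using cube_eqD(1)[OF assms(1)] assms(2) by auto
  moreover have "(1::real) < 2 ^ Suc k" by (rule one_less_power) auto
  ultimately show False using assms(2) by (auto simp: field_simps)
qed

text \<open>A cube is determined by its generation and a list of \<open>d\<close> integers, and such
  pairs are countable.\<close>

lemma countable_grid_cubes: "countable {grid_cube d a l k x |k x. True}"
proof -
  have "{grid_cube d a l k x |k x. True} \<subseteq>
     range (\<lambda>(k, m). cube d (\<lambda>i. a i + of_int (m ! i) * (l / 2 ^ k)) (l / 2 ^ k))"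
  proof clarify
    fix k x
    have "grid_cube d a l k x = (\<lambda>(k, m). cube d (\<lambda>i. a i + of_int (m ! i) * (l / 2 ^ k)) (l / 2 ^ k))
       (k, map (grid_index a l k x) [0..<d])"
      unfolding grid_cube_def cube_def by (auto intro!: PiE_cong)
    then show "grid_cube d a l k x \<in>
      range (\<lambda>(k, m). cube d (\<lambda>i. a i + of_int (m ! i) * (l / 2 ^ k)) (l / 2 ^ k))" by blast
  qed
  then show ?thesis by (rule countable_subset) simp
qed

text \<open>Otherwise each generation contributes a point of its cube outside \<open>U\<close>. The
  sides shrink to 0 and the coordinates beyond \<open>d\<close> are constantly
  \<open>undefined\<close>, so these points converge to \<open>x\<close> in the product topology,
  contradicting openness.\<close>

lemma grid_cube_subset_open:
  assumes "0 < l" "x \<in> cube d a l" "open U" "x \<in> U"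
  obtains k where "grid_cube d a l k x \<subseteq> U"
proof (rule ccontr)
  assume "\<not> thesis"
  with that have "\<forall>k. \<exists>y. y \<in> grid_cube d a l k x - U" by blast
  then obtain y where y: "\<And>k. y k \<in> grid_cube d a l k x" "\<And>k. y k \<notin> U" by (metis DiffD1 DiffD2)
  have "(\<lambda>k. y k i) \<longlonglongrightarrow> x i" for i
  proof (cases "i < d")
    case True
    have bound: "\<bar>y k i - x i\<bar> \<le> l / 2 ^ k" for k
    proof -
      define c where "c = a i + of_int (grid_index a l k x i) * (l / 2 ^ k)"
      have "z i \<in> {c..<c + l / 2 ^ k}" if "z \<in> grid_cube d a l k x" for z
        using that True unfolding grid_cube_def cube_def c_def by (auto simp: PiE_iff)
      from this[OF y(1)] this[OF grid_cube_self[OF assms(1,2)]] show ?thesis by auto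
    qed
    have "(\<lambda>k. l / 2 ^ k) \<longlonglongrightarrow> 0"
      by (intro LIMSEQ_divide_realpow_zero) auto
    then have "(\<lambda>k. y k i - x i) \<longlonglongrightarrow> 0"
      by (rule Lim_null_comparison[rotated]) (simp add: bound)
    then show ?thesis by (simp add: LIM_zero_iff)
  next
    case False
    then have "y k i = x i" for k
      using y(1)[of k] assms(1,2) subsetD[OF cube_subset_space, of x d a l]
      by (simp add: mem_grid_cube_iff space_leb extensional_def)
    then show ?thesis by simp
  qed
  then have "limitin (product_topology (\<lambda>_. euclideanreal) UNIV) y x sequentially"
    by (simp add: limitin_componentwise)
  then have "y \<longlonglongrightarrow> x" by (simp add: euclidean_product_topology)
  then have "eventually (\<lambda>k. y k \<in> U) sequentially"
    using assms(3,4) by (rule topological_tendstoD)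
  with y(2) show False by simp
qed

subsection \<open>Stopping cubes\<close>

text \<open>Each point that lies in some good cube selects the coarsest one around it. The open set
  \<open>U\<close> stays internal: the conclusion speaks of \<open>P - F\<close>, since a non-null
  part of the parent outside \<open>F\<close> is what an almost-everywhere inequality in
  \<open>y\<close> can exploit.\<close>

lemma stopping_cubes:
  assumes d: "1 \<le> d" and l: "0 < l" and Q: "Q = cube d a l"
    and F: "F \<in> sets (leb d)" "F \<subseteq> Q"
    and meas: "measure (leb d) F < \<beta> * measure (leb d) Q" and \<beta>: "\<beta> < 1"
  obtains S where "countable S" "disjoint S" "F \<subseteq> \<Union>S" "S \<subseteq> dyadic_subcubes d Q - {Q}"
    "measure (leb d) (\<Union>S) \<le> \<beta> * measure (leb d) Q"
    "\<And>R. R \<in> S \<Longrightarrow> R \<subseteq> Q \<and> R \<in> sets (leb d) \<and> (\<exists>P. dyadic_parent d Q R P \<and> P \<subseteq> Q \<and>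
        P \<in> sets (leb d) \<and> P - F \<notin> null_sets (leb d))"
proof -
  define C where "C = grid_cube d a l"
  define e where "e = \<beta> * measure (leb d) Q - measure (leb d) F"
  have e: "0 < e" using meas by (simp add: e_def)
  have fQ: "Q \<in> fmeasurable (leb d)" using fmeasurable_cube l by (simp add: Q)
  have Q_pos: "0 < measure (leb d) Q" using measure_cube_pos[OF l] by (simp add: Q)
  have C_sets [measurable]: "C k x \<in> sets (leb d)" for k x
    unfolding C_def grid_cube_def by simp
  obtain U where U: "open U" "F \<subseteq> U" "U \<inter> Q \<in> sets (leb d)"
    "measure (leb d) (U \<inter> Q) \<le> \<beta> * measure (leb d) Q"
    using outer_open_approximation[OF F[unfolded Q] less_imp_le[OF l] e] by (auto simp: Q e_def)
  \<comment> \<open>Containment is required only up to a null set, so that a cube that is not good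
    has a part of positive measure outside \<open>U\<close>, rather than merely a point.\<close>
  define good where "good k x \<longleftrightarrow> C k x - (U \<inter> Q) \<in> null_sets (leb d)" for k x
  define N where "N x = (LEAST k. good k x)" for x
  define S where "S = {C (N x) x |x. x \<in> Q \<and> (\<exists>k. good k x)}"
  have sub: "C k x \<subseteq> Q" if "x \<in> Q" for k x
    using grid_cube_subset[OF l] that by (simp add: C_def Q)
  have self: "x \<in> C k x" if "x \<in> Q" for k x
    using grid_cube_self[OF l] that by (simp add: C_def Q)
  have C_eq: "C j z = C j x" if "z \<in> C k x" "j \<le> k" for j k x z
    using grid_cube_eqI[OF l] grid_cube_antimono[OF l that(2)] that(1) unfolding C_def by blast
  have good_N: "good (N x) x" if "\<exists>k. good k x" for x
    unfolding N_def using that by (rule LeastI_ex)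
  \<comment> \<open>All points of a stopping cube have the same cubes in all coarser generations,
    hence the same stopping generation. This gives disjointness.\<close>
  have N_eq: "N z = N x" if "\<exists>k. good k x" "z \<in> C (N x) x" for x z
  proof -
    have *: "good j z \<longleftrightarrow> good j x" if "j \<le> N x" for j
      using C_eq[OF \<open>z \<in> C (N x) x\<close> that] by (simp add: good_def)
    show ?thesis unfolding N_def[of z]
    proof (rule Least_equality)
      show "good (N x) z" using * good_N[OF that(1)] by simp
      fix j assume "good j z"
      then show "N x \<le> j" using * not_less_Least[of j "\<lambda>k. good k x"] unfolding N_def[symmetric]
        by (metis not_le order.strict_implies_order)
    qed
  qed
  \<comment> \<open>If \<open>Q\<close> itself were good, \<open>U \<inter> Q\<close> would have
    full measure in \<open>Q\<close>, against the bound by \<beta> < 1. So every stopping generation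
    is positive and a parent exists.\<close>
  have not_good_0: "\<not> good 0 x" if "x \<in> Q" for x
  proof
    assume "good 0 x"
    then have "Q - (U \<inter> Q) \<in> null_sets (leb d)"
      using grid_cube_0[OF l] that by (simp add: good_def C_def Q)
    then have "measure (leb d) (Q - (U \<inter> Q)) = 0" by (simp add: measure_eq_0_null_sets)
    moreover have "measure (leb d) (Q - (U \<inter> Q)) = measure (leb d) Q - measure (leb d) (U \<inter> Q)"
      using fQ U(3) by (subst measure_Diff) (auto simp: fmeasurable_def)
    moreover have "measure (leb d) (U \<inter> Q) < measure (leb d) Q"
      using U(4) mult_strict_right_mono[OF \<beta> Q_pos] by simp
    ultimately show False by simp
  qed
  show thesis
  proof (rule that)
    show cS: "countable S"
      by (rule countable_subset[OF _ countable_grid_cubes[of d a l]]) (auto simp: S_def C_def)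
    show "disjoint S"
    proof (rule disjointI, rule ccontr)
      fix A B assume "A \<in> S" "B \<in> S" "A \<noteq> B" "A \<inter> B \<noteq> {}"
      then obtain x y z where x: "A = C (N x) x" "\<exists>k. good k x" and y: "B = C (N y) y" "\<exists>k. good k y"
        and z: "z \<in> A" "z \<in> B" by (auto simp: S_def)
      have "C (N z) z = A" using z(1) N_eq[OF x(2)] C_eq[of z "N x" x "N x"] by (simp add: x(1))
      moreover have "C (N z) z = B" using z(2) N_eq[OF y(2)] C_eq[of z "N y" y "N y"] by (simp add: y(1))
      ultimately show False using \<open>A \<noteq> B\<close> by simp
    qed
    show "F \<subseteq> \<Union>S"
    proof
      fix x assume "x \<in> F"
      then have x: "x \<in> Q" "x \<in> U" using F U by auto
      then obtain k where "C k x \<subseteq> U"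
        using grid_cube_subset_open[OF l _ U(1)] unfolding C_def Q by blast
      then have "C k x - (U \<inter> Q) = {}" using sub[OF x(1)] by blast
      then have "\<exists>k. good k x" unfolding good_def by (metis null_sets.empty_sets)
      then show "x \<in> \<Union>S" using self[OF x(1), of "N x"] x(1) unfolding S_def by blast
    qed
    have S_sets: "\<Union>S \<in> sets (leb d)"
      by (rule sets.countable_Union[OF cS]) (auto simp: S_def)
    \<comment> \<open>The countably many stopping cubes leave \<open>U \<inter> Q\<close> only by a
      null set, so the measure bound for \<open>U \<inter> Q\<close> passes to their union.\<close>
    have "\<Union>S - (U \<inter> Q) = (\<Union>R\<in>S. R - (U \<inter> Q))" by blast
    also have "\<dots> \<in> null_sets (leb d)"
      using good_N by (intro null_sets_UN'[OF cS]) (auto simp: S_def good_def)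
    finally have null: "\<Union>S - (U \<inter> Q) \<in> null_sets (leb d)" .
    have "measure (leb d) (\<Union>S) \<le> measure (leb d) ((U \<inter> Q) \<union> (\<Union>S - (U \<inter> Q)))"
      using S_sets U(3) sub
      by (intro measure_mono_fmeasurable fmeasurableI2[OF fQ]) (auto simp: S_def)
    also have "\<dots> = measure (leb d) (U \<inter> Q)"
      using null U(3) by (rule measure_Un_null_set[rotated])
    finally show "measure (leb d) (\<Union>S) \<le> \<beta> * measure (leb d) Q" using U(4) by simp
    \<comment> \<open>By minimality of \<open>N x\<close>, the cube one generation coarser, which is
      the parent, is not good.\<close>
    have S_Suc: "\<exists>x k. R = C (Suc k) x \<and> x \<in> Q \<and> \<not> good k x" if "R \<in> S" for R
    proof -
      obtain x where x: "R = C (N x) x" "x \<in> Q" "\<exists>k. good k x"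
        using \<open>R \<in> S\<close> unfolding S_def by blast
      then obtain k where k: "N x = Suc k" using good_N not_good_0 by (metis not0_implies_Suc)
      then have "\<not> good k x" unfolding N_def by (metis lessI not_less_Least)
      then show ?thesis using x k by auto
    qed
    show "S \<subseteq> dyadic_subcubes d Q - {Q}"
    proof
      fix R assume "R \<in> S"
      then obtain x k where "R = C (Suc k) x" "x \<in> Q" using S_Suc by blast
      then show "R \<in> dyadic_subcubes d Q - {Q}"
        using grid_cube_dyadic[OF l] grid_cube_Suc_neq[OF d l] unfolding C_def Q by blast
    qed
    fix R assume "R \<in> S"
    then obtain x k where R: "R = C (Suc k) x" "x \<in> Q" "\<not> good k x" using S_Suc by blast
    have "C k x - F \<notin> null_sets (leb d)"
    proof
      assume "C k x - F \<in> null_sets (leb d)"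
      then have "C k x - (U \<inter> Q) \<in> null_sets (leb d)"
        by (rule null_sets_subset) (use U F in auto)
      with R(3) show False by (simp add: good_def)
    qed
    moreover have "dyadic_parent d Q R (C k x)"
      using grid_cube_dyadic_parent[OF l] R unfolding C_def Q by simp
    ultimately show "R \<subseteq> Q \<and> R \<in> sets (leb d) \<and> (\<exists>P. dyadic_parent d Q R P \<and> P \<subseteq> Q \<and>
        P \<in> sets (leb d) \<and> P - F \<notin> null_sets (leb d))"
      using sub R C_sets by blast
  qed
qed

subsection \<open>Integrals and averages\<close>

text \<open>Write exp (c y) - 1 as the integral of c exp (c s) over 0 < s < y and exchange the
  integrals. The tail bound leaves the integral of A c exp (- (b - c) s) over s > 0, which converges
  because c < b.\<close>

lemma nn_integral_exp_tail:
  fixes f :: "'a \<Rightarrow> real"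
  assumes "finite_measure M" and f [measurable]: "f \<in> borel_measurable M"
    and nonneg: "AE x in M. 0 \<le> f x"
    and tail: "\<And>s. 0 < s \<Longrightarrow> measure M {x \<in> space M. s < f x} \<le> A * exp (- (b * s))"
    and c: "0 < c" "c < b"
  shows "(\<integral>\<^sup>+x. ennreal (exp (c * f x) - 1) \<partial>M) \<le> ennreal (A * c / (b - c))"
proof -
  interpret finite_measure M by fact
  interpret pair_sigma_finite M "lborel :: real measure" ..
  \<comment> \<open>The sign of \<open>A\<close> is forced by the tail bound at s = 1.\<close>
  have A: "0 \<le> A"
  proof -
    have "0 \<le> A * exp (- (b * 1))" by (rule order_trans[OF measure_nonneg tail]) simp
    then show ?thesis by (simp add: zero_le_mult_iff)
  qed
  define K where "K x s = (if 0 < s \<and> s < f x then ennreal (c * exp (c * s)) else 0)" for x s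
  have K_meas: "(\<lambda>(x, s). K x s) \<in> borel_measurable (M \<Otimes>\<^sub>M lborel)"
    unfolding K_def by measurable
  have "(\<integral>\<^sup>+x. ennreal (exp (c * f x) - 1) \<partial>M) = (\<integral>\<^sup>+x. (\<integral>\<^sup>+s. K x s \<partial>lborel) \<partial>M)"
  proof (rule nn_integral_cong_AE, use nonneg in eventually_elim)
    case (elim x)
    have "(\<integral>\<^sup>+s. ennreal (c * exp (c * s)) * indicator {0..f x} s \<partial>lborel)
        = ennreal (exp (c * f x) - exp (c * 0))"
      using elim c by (intro nn_integral_FTC_Icc) (auto intro!: derivative_eq_intros)
    also have "(\<integral>\<^sup>+s. ennreal (c * exp (c * s)) * indicator {0..f x} s \<partial>lborel) = (\<integral>\<^sup>+s. K x s \<partial>lborel)"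
    proof (rule nn_integral_cong_AE)
      \<comment> \<open>The integrands differ at most at the two endpoints: \<open>K\<close> uses
        the open interval, the fundamental theorem of calculus the closed one.\<close>
      show "AE s in lborel. ennreal (c * exp (c * s)) * indicator {0..f x} s = K x s"
        using AE_lborel_singleton[of 0] AE_lborel_singleton[of "f x"]
        by eventually_elim (auto simp: K_def split: split_indicator)
    qed
    finally show ?case by simp
  qed
  also have "\<dots> = (\<integral>\<^sup>+s. (\<integral>\<^sup>+x. K x s \<partial>M) \<partial>lborel)"
    by (rule Fubini'[OF K_meas, symmetric])
  also have "\<dots> \<le> (\<integral>\<^sup>+s. ennreal (A * c * exp (- ((b - c) * s))) * indicator {0..} s \<partial>lborel)"
  proof (rule nn_integral_mono)
    fix s :: real
    show "(\<integral>\<^sup>+x. K x s \<partial>M) \<le> ennreal (A * c * exp (- ((b - c) * s))) * indicator {0..} s"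
    proof (cases "0 < s")
      case True
      have "(\<integral>\<^sup>+x. K x s \<partial>M) = (\<integral>\<^sup>+x. ennreal (c * exp (c * s)) * indicator {x \<in> space M. s < f x} x \<partial>M)"
        using True by (intro nn_integral_cong) (auto simp: K_def split: split_indicator)
      also have "\<dots> = ennreal (c * exp (c * s)) * ennreal (measure M {x \<in> space M. s < f x})"
        by (subst nn_integral_cmult_indicator) (auto simp: emeasure_eq_measure)
      also have "\<dots> \<le> ennreal (c * exp (c * s)) * ennreal (A * exp (- (b * s)))"
        using tail[OF True] by (intro mult_left_mono ennreal_leI) auto
      also have "\<dots> = ennreal (A * c * exp (- ((b - c) * s)))"
        using A c by (simp add: algebra_simps exp_add[symmetric] exp_diff exp_minus divide_inverse flip: ennreal_mult)
      finally show ?thesis using True by simp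
    next
      case False
      then show ?thesis by (simp add: K_def)
    qed
  qed
  also have "\<dots> = ennreal (0 - (- (A * c / (b - c)) * exp (- ((b - c) * 0))))"
  proof (rule nn_integral_FTC_atLeast)
    fix x
    show "((\<lambda>s. - (A * c / (b - c)) * exp (- ((b - c) * s))) has_real_derivative
        A * c * exp (- ((b - c) * x))) (at x)"
    proof -
      have "((\<lambda>s. - (A * c / k) * exp (- (k * s))) has_real_derivative A * c * exp (- (k * x))) (at x)"
        if "k \<noteq> 0" for k
        using that by (auto intro!: derivative_eq_intros)
      from this[of "b - c"] show ?thesis using c by simp
    qed
    show "0 \<le> A * c * exp (- ((b - c) * x))" using A c by simp
    have "filterlim (\<lambda>s. (b - c) * s) at_top at_top"
      using c by (intro filterlim_tendsto_pos_mult_at_top[OF tendsto_const]) (auto intro: filterlim_ident)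
    then have "((\<lambda>s. exp (- ((b - c) * s))) \<longlongrightarrow> 0) at_top"
      by (intro filterlim_compose[OF exp_at_bot]) (simp add: filterlim_uminus_at_bot)
    from tendsto_mult_left[OF this, of "- (A * c / (b - c))"]
    show "((\<lambda>s. - (A * c / (b - c)) * exp (- ((b - c) * s))) \<longlongrightarrow> 0) at_top" by simp
  qed simp
  finally show ?thesis by simp
qed

lemma nn_average_cong_AE:
  assumes "AE x in leb d. x \<in> Q \<longrightarrow> f x = g x"
  shows "nn_average d Q f = nn_average d Q g"
  unfolding nn_average_def
  by (rule arg_cong2[where f = "(/)"], rule nn_integral_cong_AE, use assms in eventually_elim)
    (auto split: split_indicator)

lemma nn_average_0: "nn_average d Q (\<lambda>x. 0) = 0"
  by (simp add: nn_average_def)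

subsection \<open>Exponential decay of the distribution functions\<close>

text \<open>Common setting for the local and the global case: a family of nondegenerate cubes closed
  under dyadic subdivision covers both the subcubes of one cube and a grid of the whole
  space.\<close>

locale dyadic_pair =
  fixes d :: nat and D :: "(nat \<Rightarrow> real) set set"
    and G H :: "(nat \<Rightarrow> real) set \<Rightarrow> (nat \<Rightarrow> real) \<Rightarrow> real"
  assumes d: "1 \<le> d"
    and cubes: "\<And>Q. Q \<in> D \<Longrightarrow> \<exists>a l. 0 < l \<and> Q = cube d a l"
    and sub: "\<And>Q. Q \<in> D \<Longrightarrow> dyadic_subcubes d Q \<subseteq> D"
    and meas: "\<And>Q. Q \<in> D \<Longrightarrow> G Q \<in> borel_measurable (leb d)"
      "\<And>Q. Q \<in> D \<Longrightarrow> H Q \<in> borel_measurable (leb d)"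
    and nonneg: "\<And>Q. Q \<in> D \<Longrightarrow> AE x in leb d. 0 \<le> G Q x"
    and GH: "\<And>Q. Q \<in> D \<Longrightarrow> AE x in leb d. x \<in> Q \<longrightarrow> G Q x \<le> H Q x"
    and GG: "\<And>Q Q' P. Q \<in> D \<Longrightarrow> Q' \<in> dyadic_subcubes d Q - {Q} \<Longrightarrow> dyadic_parent d Q Q' P \<Longrightarrow>
        AE x in leb d. x \<in> Q' \<longrightarrow> (AE y in leb d. y \<in> P \<longrightarrow> G Q x \<le> G Q' x + H Q y)"
begin

lemma fmeasurable_D: "Q \<in> D \<Longrightarrow> Q \<in> fmeasurable (leb d)"
  using cubes fmeasurable_cube by fastforce

lemma measure_D_pos: "Q \<in> D \<Longrightarrow> 0 < measure (leb d) Q"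
  using cubes measure_cube_pos by blast

lemma fmeasurable_superlevel:
  assumes "R \<in> D" "f \<in> borel_measurable (leb d)"
  shows "superlevel f R s \<in> fmeasurable (leb d)"
proof (rule fmeasurableI2[OF fmeasurable_D[OF assms(1)]])
  have R: "R \<in> sets (leb d)" using fmeasurable_D[OF assms(1)] by (rule fmeasurableD)
  have "superlevel f R s = R \<inter> {x \<in> space (leb d). s < f x}"
    using sets.sets_into_space[OF R] by (auto simp: superlevel_def)
  then show "superlevel f R s \<in> sets (leb d)" using R assms(2) by simp
qed (auto simp: superlevel_def)

text \<open>Up to a null set, {\<open>G Q\<close> > t} is covered by the sets {\<open>G R\<close> >
  t - \<mu>} over the stopping cubes \<open>R\<close>. The assumed bound \<open>c\<close> is uniform
  over \<open>D\<close>, so it applies to each \<open>R\<close>, and summing costs only the total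
  measure of the stopping cubes.\<close>

lemma decay_step:
  assumes \<alpha>: "\<alpha> < 1" and c: "0 \<le> c" and t: "\<mu> \<le> t"
    and H: "\<And>Q. Q \<in> D \<Longrightarrow> measure (leb d) (superlevel (H Q) Q \<mu>) \<le> \<alpha> * measure (leb d) Q"
    and IH: "\<And>Q. Q \<in> D \<Longrightarrow> measure (leb d) (superlevel (G Q) Q (t - \<mu>)) \<le> c * measure (leb d) Q"
    and QD: "Q \<in> D"
  shows "measure (leb d) (superlevel (G Q) Q t) \<le> c * \<alpha> * measure (leb d) Q"
proof -
  obtain a l where l: "0 < l" and Q: "Q = cube d a l" using cubes[OF QD] by blast
  note fm = fmeasurable_D and sl_fm = fmeasurable_superlevel and Q_pos = measure_D_pos[OF QD]
  have sl_sub: "superlevel f R s \<subseteq> R" for f R s by (auto simp: superlevel_def)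
  have *: "measure (leb d) (superlevel (G Q) Q t) \<le> c * (\<beta> * measure (leb d) Q)"
    if \<beta>: "\<alpha> < \<beta>" "\<beta> < 1" for \<beta>
  proof -
    define F where "F = superlevel (H Q) Q \<mu>"
    have F: "F \<in> sets (leb d)" "F \<subseteq> Q"
      unfolding F_def using sl_fm[OF QD meas(2)[OF QD]] sl_sub by (auto dest: fmeasurableD)
    have "measure (leb d) F < \<beta> * measure (leb d) Q"
      using H[OF QD] mult_strict_right_mono[OF \<beta>(1) Q_pos] unfolding F_def by linarith
    from stopping_cubes[OF d l Q F this \<beta>(2)]
    obtain S where S: "countable S" "disjoint S" "F \<subseteq> \<Union>S" "S \<subseteq> dyadic_subcubes d Q - {Q}"
        "measure (leb d) (\<Union>S) \<le> \<beta> * measure (leb d) Q"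
      and SP: "\<And>R. R \<in> S \<Longrightarrow> R \<subseteq> Q \<and> R \<in> sets (leb d) \<and> (\<exists>P. dyadic_parent d Q R P \<and> P \<subseteq> Q \<and>
        P \<in> sets (leb d) \<and> P - F \<notin> null_sets (leb d))"
      by blast
    have SD: "R \<in> D" if "R \<in> S" for R using sub[OF QD] S(4) that by blast
    have SsQ: "\<Union>S \<subseteq> Q" using SP by blast
    have Ss: "\<Union>S \<in> sets (leb d)" using S(1) SP by (intro sets.countable_Union) auto
    \<comment> \<open>For almost every \<open>x\<close> the inequality holds for almost every
      \<open>y\<close> in the parent. Since \<open>P - F\<close> is not null, some such
      \<open>y\<close> lies outside \<open>F\<close>, and there
      \<open>H Q y \<le> \<mu>\<close>.\<close>
    have key: "AE x in leb d. x \<in> R \<longrightarrow> G Q x \<le> G R x + \<mu>" if R: "R \<in> S" for R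
    proof -
      obtain P where P: "dyadic_parent d Q R P" "P \<subseteq> Q" "P \<in> sets (leb d)" "P - F \<notin> null_sets (leb d)"
        using SP[OF R] by blast
      have "AE x in leb d. x \<in> R \<longrightarrow> (AE y in leb d. y \<in> P \<longrightarrow> G Q x \<le> G R x + H Q y)"
        using GG[OF QD _ P(1)] S(4) R by blast
      then show ?thesis
      proof eventually_elim
        case (elim x)
        show ?case
        proof
          assume "x \<in> R"
          with elim have ae: "AE y in leb d. y \<in> P \<longrightarrow> G Q x \<le> G R x + H Q y" by blast
          have "\<exists>y\<in>P - F. G Q x \<le> G R x + H Q y"
          proof (rule ccontr)
            assume no: "\<not> ?thesis"
            from ae have "AE y in leb d. y \<notin> P - F"
              by eventually_elim (use no in blast)
            then have "P - F \<in> null_sets (leb d)"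
              using P(3) F(1) by (simp add: AE_iff_null_sets)
            with P(4) show False by simp
          qed
          then show "G Q x \<le> G R x + \<mu>"
            using P(2) by (force simp: F_def superlevel_def)
        qed
      qed
    qed
    have ae: "AE x in leb d. x \<in> superlevel (G Q) Q t \<longrightarrow> x \<in> (\<Union>R\<in>S. superlevel (G R) R (t - \<mu>))"
    proof -
      \<comment> \<open>Countability of \<open>S\<close> allows the exceptional sets of all cubes to
        be merged into one null set.\<close>
      have "AE x in leb d. \<forall>R\<in>S. x \<in> R \<longrightarrow> G Q x \<le> G R x + \<mu>"
        using key by (simp add: AE_ball_countable[OF S(1)])
      with GH[OF QD] show ?thesis
      proof eventually_elim
        case (elim x)
        show ?case
        proof
          assume "x \<in> superlevel (G Q) Q t"
          then have x: "x \<in> Q" "t < G Q x" by (auto simp: superlevel_def)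
          \<comment> \<open>Here \<mu> \<le> t enters: \<mu> \<le> t < \<open>G Q x\<close> \<le>
            \<open>H Q x\<close>.\<close>
          then have "x \<in> F" using elim(1) t by (auto simp: F_def superlevel_def)
          then obtain R where R: "R \<in> S" "x \<in> R" using S(3) by blast
          then have "G Q x \<le> G R x + \<mu>" using elim(2) by blast
          then have "x \<in> superlevel (G R) R (t - \<mu>)" using R x by (auto simp: superlevel_def)
          then show "x \<in> (\<Union>R\<in>S. superlevel (G R) R (t - \<mu>))" using R by blast
        qed
      qed
    qed
    have sets: "superlevel (G R) R (t - \<mu>) \<in> sets (leb d)" if "R \<in> S" for R
      using sl_fm[OF SD[OF that] meas(1)[OF SD[OF that]]] by (rule fmeasurableD)
    have UU: "(\<Union>R\<in>S. superlevel (G R) R (t - \<mu>)) \<in> sets (leb d)"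
      using S(1) sets by (intro sets.countable_UN') auto
    have "emeasure (leb d) (superlevel (G Q) Q t) \<le> emeasure (leb d) (\<Union>R\<in>S. superlevel (G R) R (t - \<mu>))"
      using ae UU by (rule emeasure_mono_AE)
    \<comment> \<open>Sums over \<open>S\<close> are integrals against counting measure;
      disjointness later reassembles the measures of the cubes into that of their union.\<close>
    also have "\<dots> = (\<integral>\<^sup>+R. emeasure (leb d) (superlevel (G R) R (t - \<mu>)) \<partial>count_space S)"
    proof (rule emeasure_UN_countable)
      show "disjoint_family_on (\<lambda>R. superlevel (G R) R (t - \<mu>)) S"
        unfolding disjoint_family_on_def
        by (intro ballI impI) (metis Int_mono disjointD[OF S(2)] sl_sub subset_empty)
    qed (use S(1) sets in auto)
    also have "\<dots> \<le> (\<integral>\<^sup>+R. ennreal c * emeasure (leb d) R \<partial>count_space S)"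
    proof (rule nn_integral_mono)
      fix R assume "R \<in> space (count_space S)"
      then have R: "R \<in> S" by simp
      show "emeasure (leb d) (superlevel (G R) R (t - \<mu>)) \<le> ennreal c * emeasure (leb d) R"
        using IH[OF SD[OF R]] c unfolding emeasure_eq_measure2[OF fm[OF SD[OF R]]]
          emeasure_eq_measure2[OF sl_fm[OF SD[OF R] meas(1)[OF SD[OF R]]]]
        by (simp flip: ennreal_mult)
    qed
    also have "\<dots> = ennreal c * (\<integral>\<^sup>+R. emeasure (leb d) R \<partial>count_space S)"
      by (rule nn_integral_cmult) simp
    also have "(\<integral>\<^sup>+R. emeasure (leb d) R \<partial>count_space S) = emeasure (leb d) (\<Union>R\<in>S. R)"
    proof (rule emeasure_UN_countable[symmetric])
      show "disjoint_family_on (\<lambda>R. R) S"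
        unfolding disjoint_family_on_def by (intro ballI impI disjointD[OF S(2)])
    qed (use S(1) SP in auto)
    also have "emeasure (leb d) (\<Union>R\<in>S. R) = ennreal (measure (leb d) (\<Union>S))"
      using emeasure_eq_measure2[OF fmeasurableI2[OF fm[OF QD] SsQ Ss]] by simp
    also have "ennreal c * ennreal (measure (leb d) (\<Union>S)) \<le> ennreal (c * (\<beta> * measure (leb d) Q))"
      using c mult_left_mono[OF S(5) c] by (simp add: ennreal_leI flip: ennreal_mult)
    finally have "ennreal (measure (leb d) (superlevel (G Q) Q t)) \<le> ennreal (c * (\<beta> * measure (leb d) Q))"
      by (simp add: emeasure_eq_measure2[OF sl_fm[OF QD meas(1)[OF QD]]])
    moreover have "0 \<le> \<beta> * measure (leb d) Q"
      using measure_nonneg S(5) by (rule order_trans)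
    ultimately show ?thesis using c by simp
  qed
  \<comment> \<open>Letting \<beta> decrease to \<alpha> removes the slack that the open cover
    required.\<close>
  have "((\<lambda>\<beta>. c * (\<beta> * measure (leb d) Q)) \<longlongrightarrow> c * (\<alpha> * measure (leb d) Q)) (at_right \<alpha>)"
    by (intro tendsto_intros)
  moreover have "eventually (\<lambda>\<beta>. measure (leb d) (superlevel (G Q) Q t) \<le> c * (\<beta> * measure (leb d) Q)) (at_right \<alpha>)"
    using eventually_at_right_real[OF \<alpha>] by eventually_elim (use * in auto)
  ultimately have "measure (leb d) (superlevel (G Q) Q t) \<le> c * (\<alpha> * measure (leb d) Q)"
    by (rule tendsto_lowerbound) simp
  then show ?thesis by (simp add: mult.assoc)
qed

text \<open>Both \<open>t\<close> and \<open>Q\<close> vary in the induction, since the step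
  evaluates the bound on smaller cubes at level t - \<mu>. The case \<mu> = 0 is included: then
  every \<open>k\<close> is admissible for a given t \<ge> 0.\<close>

lemma decay_iterate:
  assumes \<alpha>: "0 \<le> \<alpha>" "\<alpha> < 1"
    and H: "\<And>Q. Q \<in> D \<Longrightarrow> measure (leb d) (superlevel (H Q) Q \<mu>) \<le> \<alpha> * measure (leb d) Q"
    and \<mu>: "0 \<le> \<mu>"
    and "real k * \<mu> \<le> t" "Q \<in> D"
  shows "measure (leb d) (superlevel (G Q) Q t) \<le> \<alpha> ^ k * measure (leb d) Q"
  using assms(5,6)
proof (induction k arbitrary: t Q)
  case 0
  then show ?case
    using fmeasurable_D[OF 0(2)] fmeasurable_superlevel[OF 0(2) meas(1)[OF 0(2)], of t]
    by (simp, intro measure_mono_fmeasurable) (auto simp: superlevel_def)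
next
  case (Suc k)
  have t: "real k * \<mu> \<le> t - \<mu>" using Suc.prems(1) by (simp add: algebra_simps)
  then have "\<mu> \<le> t" using mult_nonneg_nonneg[of "real k" \<mu>] \<mu> by linarith
  from decay_step[OF \<alpha>(2) _ this H Suc.IH[OF t] Suc.prems(2)] show ?case
    using \<alpha>(1) by (simp add: mult.commute)
qed

section \<open>Tail bounds in terms of the quantile supremum \<open>m_alpha\<close>\<close>

lemma emeasure_D: "Q \<in> D \<Longrightarrow> emeasure (leb d) Q = ennreal (measure (leb d) Q)"
  by (rule emeasure_eq_measure2[OF fmeasurable_D])

text \<open>Any level above \<mu> exceeds an admissible level for \<open>Q\<close>. The strict
  superlevel sets at \<mu> + 1 / (n + 1) increase to the one at \<mu>, so continuity from below
  carries the bound to \<mu> itself.\<close>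

lemma measure_superlevel_H:
  assumes m: "m_alpha d D H \<alpha> = ennreal \<mu>" and \<mu>: "0 \<le> \<mu>" and \<alpha>: "0 \<le> \<alpha>" and Q: "Q \<in> D"
  shows "measure (leb d) (superlevel (H Q) Q \<mu>) \<le> \<alpha> * measure (leb d) Q"
proof -
  define L where "L n = superlevel (H Q) Q (\<mu> + 1 / real (Suc n))" for n
  have fm: "superlevel (H Q) Q s \<in> fmeasurable (leb d)" for s
    by (rule fmeasurable_superlevel[OF Q meas(2)[OF Q]])
  have "emeasure (leb d) (L n) \<le> ennreal \<alpha> * emeasure (leb d) Q" for n
  proof -
    have "(INF r\<in>{r. 0 < r \<and> emeasure (leb d) (superlevel (H Q) Q r) \<le> ennreal \<alpha> * emeasure (leb d) Q}. ennreal r)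
        \<le> m_alpha d D H \<alpha>"
      unfolding m_alpha_def by (rule SUP_upper[OF Q])
    also have "\<dots> < ennreal (\<mu> + 1 / real (Suc n))"
      unfolding m using \<mu> by (intro ennreal_lessI) (simp_all add: add_nonneg_pos)
    finally obtain r where r: "0 < r" "ennreal r < ennreal (\<mu> + 1 / real (Suc n))"
        "emeasure (leb d) (superlevel (H Q) Q r) \<le> ennreal \<alpha> * emeasure (leb d) Q"
      unfolding INF_less_iff by blast
    have "r \<le> \<mu> + 1 / real (Suc n)" using r(1,2) by (simp add: ennreal_less_iff)
    then have "L n \<subseteq> superlevel (H Q) Q r" unfolding L_def superlevel_def by auto
    then have "emeasure (leb d) (L n) \<le> emeasure (leb d) (superlevel (H Q) Q r)"
      by (rule emeasure_mono) (rule fmeasurableD[OF fm])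
    then show ?thesis using r(3) by (rule order_trans)
  qed
  then have "(SUP n. emeasure (leb d) (L n)) \<le> ennreal \<alpha> * emeasure (leb d) Q"
    by (rule SUP_least)
  also have "(SUP n. emeasure (leb d) (L n)) = emeasure (leb d) (\<Union>n. L n)"
  proof (rule SUP_emeasure_incseq)
    show "range L \<subseteq> sets (leb d)" using fm unfolding L_def by (auto dest: fmeasurableD)
    show "incseq L"
    proof (rule incseq_SucI)
      fix n
      have "1 / real (Suc (Suc n)) \<le> 1 / real (Suc n)" by (intro divide_left_mono) auto
      then show "L n \<subseteq> L (Suc n)" unfolding L_def superlevel_def by auto
    qed
  qed
  also have "(\<Union>n. L n) = superlevel (H Q) Q \<mu>"
  proof
    show "(\<Union>n. L n) \<subseteq> superlevel (H Q) Q \<mu>"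
    proof clarify
      fix x n assume "x \<in> L n"
      moreover have "0 \<le> 1 / real (Suc n)" by simp
      ultimately show "x \<in> superlevel (H Q) Q \<mu>"
        unfolding L_def superlevel_def mem_Collect_eq by linarith
    qed
    show "superlevel (H Q) Q \<mu> \<subseteq> (\<Union>n. L n)"
    proof
      fix x assume x: "x \<in> superlevel (H Q) Q \<mu>"
      then have "0 < H Q x - \<mu>" by (simp add: superlevel_def)
      then obtain n where "inverse (real (Suc n)) < H Q x - \<mu>" using reals_Archimedean by blast
      then have "\<mu> + 1 / real (Suc n) < H Q x" by (simp add: inverse_eq_divide)
      then show "x \<in> (\<Union>n. L n)" using x unfolding L_def superlevel_def by blast
    qed
  qed
  finally have "ennreal (measure (leb d) (superlevel (H Q) Q \<mu>)) \<le> ennreal (\<alpha> * measure (leb d) Q)"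
    unfolding emeasure_eq_measure2[OF fm] emeasure_D[OF Q] using \<alpha> by (simp add: ennreal_mult)
  then show ?thesis using \<alpha> by simp
qed

text \<open>Iterate k = floor (t / \<mu>) times. Since k \<ge> t / \<mu> - 1, rounding down costs at
  most one factor \<alpha>, which is the origin of the prefactor 1 / \<alpha>.\<close>

lemma exponential_decay:
  assumes m: "m_alpha d D H \<alpha> = ennreal \<mu>" and \<mu>: "0 < \<mu>" and \<alpha>: "0 < \<alpha>" "\<alpha> < 1"
    and t: "0 < t" and Q: "Q \<in> D"
  shows "measure (leb d) (superlevel (G Q) Q t)
    \<le> measure (leb d) Q / \<alpha> * exp (- (ln (inverse \<alpha>) / \<mu> * t))"
proof -
  define k where "k = nat \<lfloor>t / \<mu>\<rfloor>"
  have k: "real k \<le> t / \<mu>" "t / \<mu> - 1 \<le> real k" using t \<mu> by (auto simp: k_def)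
  have "real k * \<mu> \<le> t" using k(1) \<mu> by (simp add: field_simps)
  from decay_iterate[OF _ \<alpha>(2) measure_superlevel_H[OF m] _ this Q]
  have "measure (leb d) (superlevel (G Q) Q t) \<le> \<alpha> ^ k * measure (leb d) Q"
    using \<alpha> \<mu> by simp
  also have "\<alpha> ^ k = \<alpha> powr real k" using \<alpha> by (simp add: powr_realpow)
  also have "\<dots> \<le> \<alpha> powr (t / \<mu> - 1)" using \<alpha> k(2) by (intro powr_mono') auto
  also have "\<dots> = exp (- (ln (inverse \<alpha>) / \<mu> * t)) / \<alpha>"
    using \<alpha> by (simp add: powr_diff) (simp add: powr_def ln_inverse)
  finally show ?thesis by (simp add: mult_right_mono field_simps)
qed

text \<open>With \<mu> = 0 the iteration can be repeated arbitrarily often at a fixed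
  \<open>t\<close>, and the powers of \<alpha> tend to 0.\<close>

lemma measure_superlevel_G_eq_0:
  assumes m: "m_alpha d D H \<alpha> = 0" and \<alpha>: "0 < \<alpha>" "\<alpha> < 1" and t: "0 < t" and Q: "Q \<in> D"
  shows "measure (leb d) (superlevel (G Q) Q t) = 0"
proof -
  have "measure (leb d) (superlevel (G Q) Q t) \<le> \<alpha> ^ k * measure (leb d) Q" for k
    using decay_iterate[of \<alpha> 0 k t Q] measure_superlevel_H[of \<alpha> 0] m \<alpha> t Q by simp
  moreover have "(\<lambda>k. \<alpha> ^ k * measure (leb d) Q) \<longlonglongrightarrow> 0 * measure (leb d) Q"
    using \<alpha> by (intro tendsto_intros LIMSEQ_power_zero) simp
  ultimately have "measure (leb d) (superlevel (G Q) Q t) \<le> 0"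
    by (intro LIMSEQ_le_const) auto
  then show ?thesis by (simp add: measure_le_0_iff)
qed

lemma AE_G_eq_0:
  assumes m: "m_alpha d D H \<alpha> = 0" and \<alpha>: "0 < \<alpha>" "\<alpha> < 1" and Q: "Q \<in> D"
  shows "AE x in leb d. x \<in> Q \<longrightarrow> G Q x = 0"
proof -
  have "AE x in leb d. \<forall>n. x \<notin> superlevel (G Q) Q (1 / real (Suc n))"
  proof (subst AE_all_countable, rule allI)
    fix n
    have fm: "superlevel (G Q) Q (1 / real (Suc n)) \<in> fmeasurable (leb d)"
      by (rule fmeasurable_superlevel[OF Q meas(1)[OF Q]])
    have "emeasure (leb d) (superlevel (G Q) Q (1 / real (Suc n))) = 0"
      unfolding emeasure_eq_measure2[OF fm] using measure_superlevel_G_eq_0[OF m \<alpha> _ Q] by simp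
    then show "AE x in leb d. x \<notin> superlevel (G Q) Q (1 / real (Suc n))"
      using fm by (intro AE_not_in null_setsI) (auto dest: fmeasurableD)
  qed
  with nonneg[OF Q] show ?thesis
  proof eventually_elim
    case (elim x)
    show ?case
    proof (rule impI, rule ccontr)
      assume "x \<in> Q" "G Q x \<noteq> 0"
      then have "0 < G Q x" using elim(1) by simp
      then obtain n where "inverse (real (Suc n)) < G Q x" using reals_Archimedean by blast
      then show False using elim(2) \<open>x \<in> Q\<close> by (auto simp: superlevel_def inverse_eq_divide)
    qed
  qed
qed

lemma superlevel_ratio_le:
  assumes \<alpha>: "0 < \<alpha>" "\<alpha> < 1" and t: "0 < t" and Q: "Q \<in> D"
  shows "emeasure (leb d) (superlevel (G Q) Q t) / emeasure (leb d) Q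
    \<le> ennreal (1 / \<alpha> * decay \<alpha> (m_alpha d D H \<alpha>) t)"
proof -
  have fm: "superlevel (G Q) Q t \<in> fmeasurable (leb d)"
    by (rule fmeasurable_superlevel[OF Q meas(1)[OF Q]])
  have "measure (leb d) (superlevel (G Q) Q t) \<le> 1 / \<alpha> * decay \<alpha> (m_alpha d D H \<alpha>) t * measure (leb d) Q"
  proof (cases "m_alpha d D H \<alpha>")
    \<comment> \<open>Here \<open>decay\<close> is 1, and the ratio is at most 1 \<le> 1 /
      \<alpha>.\<close>
    case top
    have "measure (leb d) (superlevel (G Q) Q t) \<le> measure (leb d) Q"
      using fmeasurable_D[OF Q] fm by (intro measure_mono_fmeasurable) (auto simp: superlevel_def)
    also have "\<dots> \<le> 1 / \<alpha> * measure (leb d) Q"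
      using \<alpha> measure_D_pos[OF Q] by (simp add: field_simps)
    finally show ?thesis using top by (simp add: decay_def)
  next
    case (real \<mu>)
    show ?thesis
    proof (cases "\<mu> = 0")
      case True
      then show ?thesis using measure_superlevel_G_eq_0[OF _ \<alpha> t Q] real by (simp add: decay_def)
    next
      case False
      then show ?thesis using exponential_decay[OF real(2) _ \<alpha> t Q] real(1)
        by (simp add: decay_def real(2) mult.commute)
    qed
  qed
  then have "measure (leb d) (superlevel (G Q) Q t) / measure (leb d) Q \<le> 1 / \<alpha> * decay \<alpha> (m_alpha d D H \<alpha>) t"
    using measure_D_pos[OF Q] by (simp add: field_simps)
  then show ?thesis
    unfolding emeasure_eq_measure2[OF fm] emeasure_D[OF Q]
    using measure_D_pos[OF Q] by (simp add: divide_ennreal ennreal_leI)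
qed

text \<open>This is \<open>nn_integral_exp_tail\<close> on the restriction of the measure to
  \<open>Q\<close>, with A = |Q| / \<alpha> and b = ln (1 / \<alpha>) / \<mu>.\<close>

lemma nn_integral_exp_G_le:
  assumes m: "m_alpha d D H \<alpha> = ennreal \<mu>" and \<mu>: "0 < \<mu>" and \<alpha>: "0 < \<alpha>" "\<alpha> < 1"
    and Q: "Q \<in> D" and c: "0 < c" "c < ln (inverse \<alpha>) / \<mu>"
  shows "(\<integral>\<^sup>+x\<in>Q. ennreal (exp (c * G Q x) - 1) \<partial>leb d)
    \<le> ennreal (measure (leb d) Q / \<alpha> * c / (ln (inverse \<alpha>) / \<mu> - c))"
proof -
  let ?M = "restrict_space (leb d) Q"
  have Qs: "Q \<in> sets (leb d)" using fmeasurable_D[OF Q] by (rule fmeasurableD)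
  have QI: "Q \<inter> space (leb d) = Q" using sets.sets_into_space[OF Qs] by blast
  have sp: "space ?M = Q" using QI by (simp add: space_restrict_space)
  have "(\<integral>\<^sup>+x. ennreal (exp (c * G Q x) - 1) \<partial>?M)
    \<le> ennreal (measure (leb d) Q / \<alpha> * c / (ln (inverse \<alpha>) / \<mu> - c))"
  proof (rule nn_integral_exp_tail)
    show "finite_measure ?M"
      using QI Qs by (intro finite_measureI) (simp add: sp emeasure_restrict_space emeasure_D[OF Q])
    show "G Q \<in> borel_measurable ?M" using meas(1)[OF Q] by (rule measurable_restrict_space1)
    show "AE x in ?M. 0 \<le> G Q x"
      using nonneg[OF Q] QI Qs by (auto simp: AE_restrict_space_iff elim: eventually_mono)
    fix s :: real assume s: "0 < s"
    have "{x \<in> space ?M. s < G Q x} = superlevel (G Q) Q s" by (auto simp: sp superlevel_def)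
    moreover have "measure ?M (superlevel (G Q) Q s) = measure (leb d) (superlevel (G Q) Q s)"
      using QI Qs by (intro measure_restrict_space) (auto simp: superlevel_def)
    ultimately show "measure ?M {x \<in> space ?M. s < G Q x}
        \<le> measure (leb d) Q / \<alpha> * exp (- (ln (inverse \<alpha>) / \<mu> * s))"
      using exponential_decay[OF m \<mu> \<alpha> s Q] by simp
  qed (use c in auto)
  then show ?thesis using QI Qs by (simp add: nn_integral_restrict_space)
qed

subsection \<open>Norm bounds\<close>

lemma nn_average_le:
  assumes Q: "Q \<in> D" and c: "0 \<le> c"
    and "(\<integral>\<^sup>+x\<in>Q. ennreal (f x) \<partial>leb d) \<le> ennreal (c * measure (leb d) Q)"
  shows "nn_average d Q f \<le> ennreal c"
proof -
  have "nn_average d Q f \<le> ennreal (c * measure (leb d) Q) / ennreal (measure (leb d) Q)"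
    unfolding nn_average_def emeasure_D[OF Q] using assms(3) by (rule divide_right_mono_ennreal)
  also have "\<dots> = ennreal c"
    using c measure_D_pos[OF Q] by (simp add: divide_ennreal)
  finally show ?thesis .
qed

lemma expL_norm_le:
  assumes \<alpha>: "0 < \<alpha>" "\<alpha> < 1" and Q: "Q \<in> D"
  shows "expL_norm d Q (G Q) \<le> ennreal ((1 + inverse \<alpha>) / ln (inverse \<alpha>)) * m_alpha d D H \<alpha>"
proof -
  have ln: "0 < ln (inverse \<alpha>)" using \<alpha> by (simp add: one_less_inverse)
  have pos: "0 < (1 + inverse \<alpha>) / ln (inverse \<alpha>)" using ln \<alpha> by (simp add: add_pos_pos)
  have *: "expL_norm d Q (G Q) \<le> ennreal t"
    if "0 < t" "nn_average d Q (\<lambda>x. exp (\<bar>G Q x\<bar> / t) - 1) \<le> 1" for t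
    unfolding expL_norm_def using that by (intro INF_lower) simp
  show ?thesis
  proof (cases "m_alpha d D H \<alpha>")
    case top
    \<comment> \<open>Positivity of the coefficient matters, as \<open>0 * top = 0\<close> in
      \<open>ennreal\<close>.\<close>
    have "ennreal x * top = top" if "0 < x" for x
      using that by (simp add: ennreal_mult_top)
    from this[OF pos] show ?thesis by (simp only: top top_greatest)
  next
    case (real \<mu>)
    show ?thesis
    proof (cases "\<mu> = 0")
      case True
      then have m0: "m_alpha d D H \<alpha> = 0" using real(2) by simp
      \<comment> \<open>\<open>G Q\<close> vanishes almost everywhere on \<open>Q\<close>, so every
        t > 0 is admissible and the infimum is 0.\<close>
      have "expL_norm d Q (G Q) \<le> ennreal t" if t: "0 < t" for t
      proof (rule *[OF t])
        have "AE x in leb d. x \<in> Q \<longrightarrow> exp (\<bar>G Q x\<bar> / t) - 1 = 0"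
          using AE_G_eq_0[OF m0 \<alpha> Q] by eventually_elim simp
        then have "nn_average d Q (\<lambda>x. exp (\<bar>G Q x\<bar> / t) - 1) = nn_average d Q (\<lambda>x. 0)"
          by (rule nn_average_cong_AE)
        then show "nn_average d Q (\<lambda>x. exp (\<bar>G Q x\<bar> / t) - 1) \<le> 1"
          by (simp add: nn_average_0)
      qed
      then have "expL_norm d Q (G Q) \<le> 0 + ennreal t" if "0 < t" for t using that by simp
      then have "expL_norm d Q (G Q) \<le> 0" by (rule ennreal_le_epsilon)
      then show ?thesis by simp
    next
      case False
      then have \<mu>: "0 < \<mu>" using real by simp
      define b where "b = ln (inverse \<alpha>) / \<mu>"
      \<comment> \<open>The solution of c / (\<alpha> (b - c)) = 1, which makes the bound on the
        average exactly 1. Its inverse is the claimed norm bound.\<close>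
      define c where "c = b * \<alpha> / (1 + \<alpha>)"
      have b: "0 < b" unfolding b_def using ln \<mu> by simp
      have c: "0 < c" "c < b" unfolding c_def using b \<alpha> by (auto simp: field_simps)
      have "c * (1 + \<alpha>) = b * \<alpha>" unfolding c_def using \<alpha> by simp
      then have "c = \<alpha> * (b - c)" by (simp add: algebra_simps)
      then have cb: "c / (b - c) = \<alpha>" using c by (simp add: divide_eq_eq)
      have "measure (leb d) Q / \<alpha> * c / (b - c) = measure (leb d) Q / \<alpha> * (c / (b - c))" by simp
      also have "\<dots> = 1 * measure (leb d) Q" unfolding cb using \<alpha> by simp
      finally have "(\<integral>\<^sup>+x\<in>Q. ennreal (exp (c * G Q x) - 1) \<partial>leb d) \<le> ennreal (1 * measure (leb d) Q)"
        using nn_integral_exp_G_le[OF real(2) \<mu> \<alpha> Q c[unfolded b_def]] by (simp add: b_def)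
      then have "nn_average d Q (\<lambda>x. exp (c * G Q x) - 1) \<le> ennreal 1"
        by (intro nn_average_le[OF Q]) auto
      moreover have "AE x in leb d. x \<in> Q \<longrightarrow> exp (c * G Q x) - 1 = exp (\<bar>G Q x\<bar> / inverse c) - 1"
        using nonneg[OF Q] by eventually_elim (simp add: divide_inverse mult.commute)
      then have "nn_average d Q (\<lambda>x. exp (c * G Q x) - 1) = nn_average d Q (\<lambda>x. exp (\<bar>G Q x\<bar> / inverse c) - 1)"
        by (rule nn_average_cong_AE)
      ultimately have "expL_norm d Q (G Q) \<le> ennreal (inverse c)" using c by (intro *) auto
      also have "inverse c = (1 + inverse \<alpha>) / ln (inverse \<alpha>) * \<mu>"
        unfolding c_def b_def using \<alpha> ln \<mu> by (simp add: field_simps)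
      also have "ennreal \<dots> = ennreal ((1 + inverse \<alpha>) / ln (inverse \<alpha>)) * ennreal \<mu>"
        using pos \<mu> by (intro ennreal_mult) auto
      finally show ?thesis by (simp add: real(2))
    qed
  qed
qed

text \<open>The power is dominated by an exponential of half the decay rate b. At c = b / 2 the
  factor c / (b - c) is 1, so the average is at most K (1 / \<alpha> + 1) \<le> 2 K / \<alpha>, and
  the root of order q gives the constant.\<close>

lemma Lq_average_le:
  assumes \<alpha>: "0 < \<alpha>" "\<alpha> < 1" and q: "0 < q" and Q: "Q \<in> D"
  shows "ennreal_powr (nn_average d Q (\<lambda>x. G Q x powr q)) (1 / q)
    \<le> ennreal (2 * q * 2 powr (1 / q) * (1 / (\<alpha> powr (1 / q) * ln (inverse \<alpha>)))) * m_alpha d D H \<alpha>"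
proof -
  have ln: "0 < ln (inverse \<alpha>)" using \<alpha> by (simp add: one_less_inverse)
  have pos: "0 < 2 * q * 2 powr (1 / q) * (1 / (\<alpha> powr (1 / q) * ln (inverse \<alpha>)))"
    using ln \<alpha> q by simp
  show ?thesis
  proof (cases "m_alpha d D H \<alpha>")
    case top
    have "ennreal x * top = top" if "0 < x" for x
      using that by (simp add: ennreal_mult_top)
    from this[OF pos] show ?thesis by (simp only: top top_greatest)
  next
    case (real \<mu>)
    show ?thesis
    proof (cases "\<mu> = 0")
      case True
      then have m0: "m_alpha d D H \<alpha> = 0" using real(2) by simp
      have "AE x in leb d. x \<in> Q \<longrightarrow> G Q x powr q = 0"
        using AE_G_eq_0[OF m0 \<alpha> Q] by eventually_elim simp
      then have "nn_average d Q (\<lambda>x. G Q x powr q) = nn_average d Q (\<lambda>x. 0)"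
        by (rule nn_average_cong_AE)
      then show ?thesis by (simp add: nn_average_0 ennreal_powr_def)
    next
      case False
      then have \<mu>: "0 < \<mu>" using real by simp
      define b where "b = ln (inverse \<alpha>) / \<mu>"
      have b: "0 < b" unfolding b_def using ln \<mu> by simp
      define K where "K = (2 * q / b) powr q"
      have K: "0 < K" unfolding K_def using b q by simp
      \<comment> \<open>Raise u \<le> exp u to the power q at u = b y / (2 q); \<open>K\<close> is
        the factor that undoes this scaling.\<close>
      have powr_le: "y powr q \<le> K * exp (b / 2 * y)" if "0 \<le> y" for y
      proof -
        have "y powr q = K * (b * y / (2 * q)) powr q"
          unfolding K_def using b q that by (subst powr_mult[symmetric]) auto
        also have "(b * y / (2 * q)) powr q \<le> exp (b * y / (2 * q)) powr q"
        proof (rule powr_mono2)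
          show "b * y / (2 * q) \<le> exp (b * y / (2 * q))"
            by (rule order_trans[OF _ exp_ge_add_one_self]) simp
        qed (use b q that in auto)
        also have "\<dots> = exp (b / 2 * y)" using q by (simp add: powr_def)
        finally show ?thesis using K by simp
      qed
      have [measurable]: "Q \<in> sets (leb d)" using fmeasurable_D[OF Q] by (rule fmeasurableD)
      have [measurable]: "G Q \<in> borel_measurable (leb d)" by (rule meas(1)[OF Q])
      have "(\<integral>\<^sup>+x\<in>Q. ennreal (G Q x powr q) \<partial>leb d)
          \<le> (\<integral>\<^sup>+x. ennreal K * (ennreal (exp (b / 2 * G Q x) - 1) * indicator Q x + indicator Q x) \<partial>leb d)"
      proof (rule nn_integral_mono_AE, use nonneg[OF Q] in eventually_elim)
        case (elim x)
        \<comment> \<open>The 1 is split off because the integral estimate controls the exponential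
          minus 1; it contributes |Q|.\<close>
        have "ennreal (G Q x powr q) \<le> ennreal (K * ((exp (b / 2 * G Q x) - 1) + 1))"
          using powr_le[OF elim] by (intro ennreal_leI) simp
        also have "\<dots> = ennreal K * (ennreal (exp (b / 2 * G Q x) - 1) + 1)"
        proof -
          have "ennreal (K * (u + 1)) = ennreal K * (ennreal u + 1)" if "0 \<le> u" for u
            using that K by (simp add: ennreal_mult ennreal_plus)
          moreover have "0 \<le> exp (b / 2 * G Q x) - 1" using elim b by simp
          ultimately show ?thesis by blast
        qed
        finally show ?case by (auto split: split_indicator)
      qed
      also have "\<dots> = ennreal K * ((\<integral>\<^sup>+x\<in>Q. ennreal (exp (b / 2 * G Q x) - 1) \<partial>leb d) + emeasure (leb d) Q)"
        by (simp add: nn_integral_cmult nn_integral_add)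
      also have "\<dots> \<le> ennreal K * (ennreal (measure (leb d) Q / \<alpha>) + ennreal (measure (leb d) Q))"
        using nn_integral_exp_G_le[OF real(2) \<mu> \<alpha> Q, folded b_def, of "b / 2"] b
        by (intro mult_left_mono add_mono) (simp_all add: emeasure_D[OF Q])
      also have "\<dots> = ennreal (K * (measure (leb d) Q / \<alpha> + measure (leb d) Q))"
        using K \<alpha> by (simp add: ennreal_mult ennreal_plus)
      also have "\<dots> \<le> ennreal (K * (2 / \<alpha>) * measure (leb d) Q)"
        using K \<alpha> measure_D_pos[OF Q] by (intro ennreal_leI) (simp add: field_simps)
      finally have "nn_average d Q (\<lambda>x. G Q x powr q) \<le> ennreal (K * (2 / \<alpha>))"
        using K \<alpha> by (intro nn_average_le[OF Q]) auto
      \<comment> \<open>The average is finite, so \<open>ennreal_powr\<close> reduces to a real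
        power.\<close>
      then obtain r where r: "nn_average d Q (\<lambda>x. G Q x powr q) = ennreal r" "0 \<le> r" "r \<le> K * (2 / \<alpha>)"
        using K \<alpha> by (cases "nn_average d Q (\<lambda>x. G Q x powr q)") (auto simp: top_unique)
      have "r powr (1 / q) \<le> (K * (2 / \<alpha>)) powr (1 / q)" using r q by (intro powr_mono2) auto
      also have "\<dots> = (2 * q / b) * (2 powr (1 / q) / \<alpha> powr (1 / q))"
        using K \<alpha> b q by (simp add: powr_mult powr_divide K_def powr_powr)
      also have "\<dots> = 2 * q * 2 powr (1 / q) * (1 / (\<alpha> powr (1 / q) * ln (inverse \<alpha>))) * \<mu>"
        unfolding b_def using \<mu> ln by (simp add: field_simps)
      finally have "ennreal (r powr (1 / q))
          \<le> ennreal (2 * q * 2 powr (1 / q) * (1 / (\<alpha> powr (1 / q) * ln (inverse \<alpha>))) * \<mu>)"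
        by (rule ennreal_leI)
      also have "\<dots> = ennreal (2 * q * 2 powr (1 / q) * (1 / (\<alpha> powr (1 / q) * ln (inverse \<alpha>)))) * ennreal \<mu>"
        using pos \<mu> by (intro ennreal_mult) auto
      finally show ?thesis using r by (simp add: ennreal_powr_def real(2))
    qed
  qed
qed

end

subsection \<open>Dyadic families\<close>

lemma dyadic_subcubes_cube:
  assumes "R \<in> dyadic_subcubes d Q" "0 < l" "Q = cube d a l"
  shows "\<exists>a l. 0 < l \<and> R = cube d a l"
  using assms
proof (induction rule: dyadic_subcubes.induct)
  case (subdivide a l b)
  then show ?case by (intro exI[of _ b] exI[of _ "l / 2"]) simp
qed blast

text \<open>Gives the subcubes of a fixed cube the closure property that \<open>dyadic_grid\<close>
  has by definition.\<close>

lemma dyadic_subcubes_trans: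
  assumes "R \<in> dyadic_subcubes d P" "P \<in> dyadic_subcubes d Q"
  shows "R \<in> dyadic_subcubes d Q"
  using assms by (induction rule: dyadic_subcubes.induct) (auto intro: dyadic_subcubes.subdivide)

lemma dyadic_family_cube:
  assumes "dyadic_family d Q0 D" "Q \<in> D"
  shows "\<exists>a l. 0 < l \<and> Q = cube d a l"
  using assms(1) unfolding dyadic_family_def
proof
  assume "(\<exists>a l. 0 < l \<and> Q0 = cube d a l) \<and> D = dyadic_subcubes d Q0"
  then show ?thesis using dyadic_subcubes_cube assms(2) by blast
next
  assume "Q0 = space (leb d) \<and> dyadic_grid d D"
  then obtain l0 where "0 < l0" "\<forall>Q\<in>D. \<exists>a (k::int). Q = cube d a (l0 * 2 powi k)"
    unfolding dyadic_grid_def by (elim conjE exE) (rule that)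
  then obtain a and k :: int where "Q = cube d a (l0 * 2 powi k)" using assms(2) by blast
  moreover have "0 < l0 * 2 powi k" using \<open>0 < l0\<close> by simp
  ultimately show ?thesis by blast
qed

lemma dyadic_family_closed:
  assumes "dyadic_family d Q0 D" "Q \<in> D"
  shows "dyadic_subcubes d Q \<subseteq> D"
  using assms dyadic_subcubes_trans unfolding dyadic_family_def dyadic_grid_def by blast

theorem propositionA2:
  shows "\<exists>C :: real \<Rightarrow> real. (\<forall>q>0. 0 < C q) \<and>
    (\<forall>(n::nat) Q0 D (G :: (nat \<Rightarrow> real) set \<Rightarrow> (nat \<Rightarrow> real) \<Rightarrow> real)
        (H :: (nat \<Rightarrow> real) set \<Rightarrow> (nat \<Rightarrow> real) \<Rightarrow> real).
      2 \<le> n \<longrightarrow>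
      dyadic_family (n - 1) Q0 D \<longrightarrow>
      (\<forall>Q\<in>D. G Q \<in> L1_loc (n - 1) \<and> H Q \<in> L1_loc (n - 1)) \<longrightarrow>
      (\<forall>Q\<in>D. (AE x in leb (n - 1). 0 \<le> G Q x) \<and> (AE x in leb (n - 1). 0 \<le> H Q x)) \<longrightarrow>
      (\<forall>Q\<in>D. AE x in leb (n - 1). x \<in> Q \<longrightarrow> G Q x \<le> H Q x) \<longrightarrow>
      (\<forall>Q\<in>D. \<forall>Q'\<in>dyadic_subcubes (n - 1) Q - {Q}. \<forall>P. dyadic_parent (n - 1) Q Q' P \<longrightarrow>
        (AE x in leb (n - 1). x \<in> Q' \<longrightarrow>
          (AE y in leb (n - 1). y \<in> P \<longrightarrow> G Q x \<le> G Q' x + H Q y))) \<longrightarrow>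
      (\<forall>\<alpha>::real. 0 < \<alpha> \<and> \<alpha> < 1 \<longrightarrow>
        (\<forall>t>0. (SUP Q\<in>D. emeasure (leb (n - 1)) (superlevel (G Q) Q t) / emeasure (leb (n - 1)) Q)
            \<le> ennreal (1 / \<alpha> * decay \<alpha> (m_alpha (n - 1) D H \<alpha>) t)) \<and>
        (SUP Q\<in>D. expL_norm (n - 1) Q (G Q))
            \<le> ennreal ((1 + inverse \<alpha>) / ln (inverse \<alpha>)) * m_alpha (n - 1) D H \<alpha> \<and>
        (\<forall>q>0. (SUP Q\<in>D. ennreal_powr (nn_average (n - 1) Q (\<lambda>x. G Q x powr q)) (1 / q))
            \<le> ennreal (C q * (1 / (\<alpha> powr (1 / q) * ln (inverse \<alpha>)))) * m_alpha (n - 1) D H \<alpha>)))"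
\<comment> \<open>The constant is the one obtained in \<open>Lq_average_le\<close>. It is fixed
  before dimension, family and functions, so it depends on \<open>q\<close> alone.\<close>
proof (intro exI[of _ "\<lambda>q. 2 * q * 2 powr (1 / q)"] conjI allI impI)
  fix q :: real assume "0 < q"
  then show "0 < 2 * q * 2 powr (1 / q)" by simp
next
  fix n :: nat and Q0 D and G H :: "(nat \<Rightarrow> real) set \<Rightarrow> (nat \<Rightarrow> real) \<Rightarrow> real" and \<alpha> :: real
  assume n: "2 \<le> n" and D: "dyadic_family (n - 1) Q0 D"
    and L1: "\<forall>Q\<in>D. G Q \<in> L1_loc (n - 1) \<and> H Q \<in> L1_loc (n - 1)"
    and nonneg: "\<forall>Q\<in>D. (AE x in leb (n - 1). 0 \<le> G Q x) \<and> (AE x in leb (n - 1). 0 \<le> H Q x)"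
    and GH: "\<forall>Q\<in>D. AE x in leb (n - 1). x \<in> Q \<longrightarrow> G Q x \<le> H Q x"
    and GG: "\<forall>Q\<in>D. \<forall>Q'\<in>dyadic_subcubes (n - 1) Q - {Q}. \<forall>P. dyadic_parent (n - 1) Q Q' P \<longrightarrow>
        (AE x in leb (n - 1). x \<in> Q' \<longrightarrow>
          (AE y in leb (n - 1). y \<in> P \<longrightarrow> G Q x \<le> G Q' x + H Q y))"
    and \<alpha>: "0 < \<alpha> \<and> \<alpha> < 1"
  interpret dyadic_pair "n - 1" D G H
  proof
    show "1 \<le> n - 1" using n by simp
    fix Q assume Q: "Q \<in> D"
    show "\<exists>a l. 0 < l \<and> Q = cube (n - 1) a l" by (rule dyadic_family_cube[OF D Q])
    show "dyadic_subcubes (n - 1) Q \<subseteq> D" by (rule dyadic_family_closed[OF D Q])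
    show "G Q \<in> borel_measurable (leb (n - 1))" "H Q \<in> borel_measurable (leb (n - 1))"
      using L1 Q by (auto simp: L1_loc_def)
    show "AE x in leb (n - 1). 0 \<le> G Q x" using nonneg Q by blast
    show "AE x in leb (n - 1). x \<in> Q \<longrightarrow> G Q x \<le> H Q x" using GH Q by blast
    fix Q' P assume "Q' \<in> dyadic_subcubes (n - 1) Q - {Q}" "dyadic_parent (n - 1) Q Q' P"
    then show "AE x in leb (n - 1). x \<in> Q' \<longrightarrow>
        (AE y in leb (n - 1). y \<in> P \<longrightarrow> G Q x \<le> G Q' x + H Q y)"
      using GG Q by blast
  qed
  show "(SUP Q\<in>D. emeasure (leb (n - 1)) (superlevel (G Q) Q t) / emeasure (leb (n - 1)) Q)
      \<le> ennreal (1 / \<alpha> * decay \<alpha> (m_alpha (n - 1) D H \<alpha>) t)" if "0 < t" for t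
    using superlevel_ratio_le \<alpha> that by (intro SUP_least) blast
  show "(SUP Q\<in>D. expL_norm (n - 1) Q (G Q))
      \<le> ennreal ((1 + inverse \<alpha>) / ln (inverse \<alpha>)) * m_alpha (n - 1) D H \<alpha>"
    using expL_norm_le \<alpha> by (intro SUP_least) blast
  show "(SUP Q\<in>D. ennreal_powr (nn_average (n - 1) Q (\<lambda>x. G Q x powr q)) (1 / q))
      \<le> ennreal (2 * q * 2 powr (1 / q) * (1 / (\<alpha> powr (1 / q) * ln (inverse \<alpha>)))) * m_alpha (n - 1) D H \<alpha>"
    if "0 < q" for q
    using Lq_average_le \<alpha> that by (intro SUP_least) blast
qed

end
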